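(* There is an algorithm that, given an $n$-vertex graph $G$ of neighbor-depth $k$ (and a vertex weight function $w : V(G)\to\mathbb{Z}_{\ge 0}$), determines the neighbor-depth of $G$ and solves \textsc{Independent Set} (finds an independent set of maximum total weight) in time $n^{O(k)}$.
   Context: The neighbor-depth $\mathrm{nd}(G)$ of a graph $G$ is defined recursively: (1) $\mathrm{nd}(G) = 0$ if and only if $V(G) = \emptyset$; (2) if $G$ is not connected, $\mathrm{nd}(G)$ is the maximum of $\mathrm{nd}(G[C])$ over connected components $C$ of $G$; (3) if $G$ is non-empty and connected, then $\mathrm{nd}(G) \le k$ if and only if there exists $v \in V(G)$ with $\mathrm{nd}(G \setminus N[v]) \le k-1$ and $\mathrm{nd}(G \setminus \{v\}) \le k$. Here $N[v]$ is the closed neighborhood of $v$ and $G\setminus X = G[V(G)\setminus X]$. *)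

theory Defs
  imports Main
begin

section \<open>Simple graphs and neighbor-depth\<close>

record 'a graph =
  verts :: "'a set"
  edges :: "('a \<times> 'a) set"

definition simple_graph :: "'a graph \<Rightarrow> bool" where
  "simple_graph G \<longleftrightarrow> finite (verts G) \<and> edges G \<subseteq> verts G \<times> verts G
     \<and> sym (edges G) \<and> irrefl (edges G)"

definition induced :: "'a graph \<Rightarrow> 'a set \<Rightarrow> 'a graph" where
  "induced G S = \<lparr>verts = verts G \<inter> S, edges = edges G \<inter> S \<times> S\<rparr>"

definition del_verts :: "'a graph \<Rightarrow> 'a set \<Rightarrow> 'a graph" where
  "del_verts G X = induced G (verts G - X)"

definition closed_nbhd :: "'a graph \<Rightarrow> 'a \<Rightarrow> 'a set" where
  "closed_nbhd G v = insert v {u. (v, u) \<in> edges G}"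

definition connected_graph :: "'a graph \<Rightarrow> bool" where
  "connected_graph G \<longleftrightarrow> (\<forall>u\<in>verts G. \<forall>v\<in>verts G. (u, v) \<in> (edges G)\<^sup>*)"

definition components :: "'a graph \<Rightarrow> 'a set set" where
  "components G = (\<lambda>v. {u \<in> verts G. (v, u) \<in> (edges G)\<^sup>*}) ` verts G"

definition independent :: "'a graph \<Rightarrow> 'a set \<Rightarrow> bool" where
  "independent G S \<longleftrightarrow> S \<subseteq> verts G \<and> (\<forall>u\<in>S. \<forall>v\<in>S. (u, v) \<notin> edges G)"

definition max_weight_independent :: "'a graph \<Rightarrow> ('a \<Rightarrow> nat) \<Rightarrow> 'a set \<Rightarrow> bool" where
  "max_weight_independent G w S \<longleftrightarrow>
     independent G S \<and> (\<forall>T. independent G T \<longrightarrow> sum w T \<le> sum w S)"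

lemma verts_induced [simp]: "verts (induced G S) = verts G \<inter> S"
  and edges_induced [simp]: "edges (induced G S) = edges G \<inter> S \<times> S"
  by (simp_all add: induced_def)

lemma simple_graph_induced: "simple_graph G \<Longrightarrow> simple_graph (induced G S)"
  by (auto simp: simple_graph_def sym_def irrefl_def)

lemma component_psubset:
  assumes "simple_graph G" and "\<not> connected_graph G" and "C \<in> components G"
  shows "C \<subset> verts G"
proof -
  have s: "sym ((edges G)\<^sup>*)"
    using assms(1) by (simp add: simple_graph_def sym_rtrancl)
  obtain v where v: "v \<in> verts G" "C = {u \<in> verts G. (v, u) \<in> (edges G)\<^sup>*}"
    using assms(3) by (auto simp: components_def)
  have "C \<noteq> verts G"
  proof
    assume "C = verts G"
    then have "\<forall>u\<in>verts G. (v, u) \<in> (edges G)\<^sup>*"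
      using v by blast
    then have "connected_graph G"
      unfolding connected_graph_def using s by (meson rtrancl_trans symD)
    then show False
      using assms(2) by contradiction
  qed
  then show ?thesis
    using v by auto
qed

text \<open>
  On a connected non-empty graph, \<open>nd H < k\<close> renders \<open>nd H \<le> k - 1\<close>, which fails for
  \<open>k = 0\<close>.  Outside simple graphs the value is a dummy; on simple graphs the function
  satisfies the defining clauses \<open>nd_eq_0_iff\<close>, \<open>nd_disconnected\<close> and
  \<open>nd_connected_le_iff\<close> below.
\<close>

function nd :: "'a graph \<Rightarrow> nat" where
  "nd G =
     (if \<not> simple_graph G \<or> verts G = {} then 0
      else if \<not> connected_graph G then Max ((\<lambda>C. nd (induced G C)) ` components G)
      else (LEAST k. \<exists>v\<in>verts G. nd (del_verts G (closed_nbhd G v)) < k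
                              \<and> nd (del_verts G {v}) \<le> k))"
  by auto

termination
proof (relation "measure (\<lambda>G. card (verts G))", goal_cases)
  case 1
  show ?case by simp
next
  case (2 G C)
  then have "C \<subset> verts G" "finite (verts G)"
    using component_psubset by (auto simp: simple_graph_def)
  then show ?case
    by (simp add: Int_absorb1 psubset_card_mono psubset_imp_subset)
next
  case (3 G k v)
  then have "verts G \<inter> (verts G - closed_nbhd G v) \<subset> verts G" "finite (verts G)"
    by (auto simp: simple_graph_def closed_nbhd_def)
  then show ?case
    by (simp add: del_verts_def psubset_card_mono)
next
  case (4 G k v)
  then have "verts G \<inter> (verts G - {v}) \<subset> verts G" "finite (verts G)"
    by (auto simp: simple_graph_def)
  then show ?case
    by (simp add: del_verts_def psubset_card_mono)
qed

declare nd.simps [simp del]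

lemma nd_disconnected:
  assumes "simple_graph G" and "\<not> connected_graph G"
  shows "nd G = Max ((\<lambda>C. nd (induced G C)) ` components G)"
proof -
  have "verts G \<noteq> {}"
    using assms(2) by (auto simp: connected_graph_def)
  then show ?thesis
    using assms by (subst nd.simps) simp
qed

lemma nd_connected_le_iff:
  assumes "simple_graph G" and "verts G \<noteq> {}" and "connected_graph G"
  shows "nd G \<le> k \<longleftrightarrow> (\<exists>v\<in>verts G. nd (del_verts G (closed_nbhd G v)) < k
                                   \<and> nd (del_verts G {v}) \<le> k)"
    (is "_ \<longleftrightarrow> ?P k")
proof -
  have eq: "nd G = (LEAST k. ?P k)"
    using assms by (subst nd.simps) simp
  obtain v where v: "v \<in> verts G"
    using assms(2) by auto
  have mono: "?P j" if "?P i" "i \<le> j" for i j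
    using that by (meson le_trans less_le_trans)
  have "?P (max (Suc (nd (del_verts G (closed_nbhd G v)))) (nd (del_verts G {v})))"
    using v by (intro bexI[of _ v]) auto
  then have "?P (nd G)"
    unfolding eq by (rule LeastI)
  show ?thesis
  proof
    assume "nd G \<le> k"
    with \<open>?P (nd G)\<close> show "?P k" by (rule mono)
  next
    assume "?P k"
    then show "nd G \<le> k"
      unfolding eq by (rule Least_le)
  qed
qed

lemma nd_eq_0_iff:
  assumes "simple_graph G"
  shows "nd G = 0 \<longleftrightarrow> verts G = {}"
  using assms
proof (induction "card (verts G)" arbitrary: G rule: less_induct)
  case less
  show ?case
  proof (cases "verts G = {}")
    case True
    then show ?thesis by (simp add: nd.simps)
  next
    case ne: False
    show ?thesis
    proof (cases "connected_graph G")
      case True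
      then show ?thesis
        using nd_connected_le_iff[OF less.prems ne, of 0] ne by simp
    next
      case False
      obtain v where v: "v \<in> verts G" using ne by auto
      define C where "C = {u \<in> verts G. (v, u) \<in> (edges G)\<^sup>*}"
      have C: "C \<in> components G" "v \<in> C"
        using v by (auto simp: C_def components_def)
      have sub: "C \<subset> verts G"
        by (rule component_psubset[OF less.prems False C(1)])
      have fin: "finite (verts G)"
        using less.prems by (simp add: simple_graph_def)
      have "card (verts (induced G C)) < card (verts G)"
        using sub fin by (simp add: Int_absorb1 psubset_card_mono psubset_imp_subset)
      then have "nd (induced G C) \<noteq> 0"
        using less.hyps[OF _ simple_graph_induced[OF less.prems]] v C by auto
      moreover have "nd (induced G C) \<le> nd G"
        unfolding nd_disconnected[OF less.prems False]
        using fin C by (intro Max_ge) (auto simp: components_def)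
      ultimately show ?thesis using ne by simp
    qed
  qed
qed


section \<open>Algorithms and running time\<close>

text \<open>
  Algorithms are programs of an imperative language with recursive procedures for a
  unit-cost RAM.  Memory cells and local variables hold natural numbers, which are unbounded
  because weights are arbitrary; the only arithmetic is addition, truncated subtraction and
  comparison.  There is no multiplication, so \<open>t\<close> steps lengthen numbers by at most \<open>O(t)\<close>
  bits, and unit cost is polynomially related to bit cost.  A program is a fixed finite
  object, so variables, constants and procedure frames have constant size, and calls can be
  compiled to a RAM with constant overhead.
\<close>

datatype exp =
    Const nat
  | Var nat
  | Mem exp
  | Plus exp exp
  | Minus exp exp
  | Less exp exp

text \<open>\<open>Call x p es\<close> runs procedure number \<open>p\<close> with arguments \<open>es\<close> and stores its result in
  \<open>x\<close>.\<close>

datatype com =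
    Skip
  | Assign nat exp
  | Store exp exp
  | Seq com com
  | If exp com com
  | While exp com
  | Call nat nat "exp list"

type_synonym program = "com list"

fun eval :: "exp \<Rightarrow> (nat \<Rightarrow> nat) \<Rightarrow> (nat \<Rightarrow> nat) \<Rightarrow> nat" where
  "eval (Const i) l m = i"
| "eval (Var x) l m = l x"
| "eval (Mem a) l m = m (eval a l m)"
| "eval (Plus a b) l m = eval a l m + eval b l m"
| "eval (Minus a b) l m = eval a l m - eval b l m"
| "eval (Less a b) l m = (if eval a l m < eval b l m then 1 else 0)"

fun cost :: "exp \<Rightarrow> nat" where
  "cost (Const i) = 1"
| "cost (Var x) = 1"
| "cost (Mem a) = 1 + cost a"
| "cost (Plus a b) = 1 + cost a + cost b"
| "cost (Minus a b) = 1 + cost a + cost b"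
| "cost (Less a b) = 1 + cost a + cost b"

definition zero_extend :: "nat list \<Rightarrow> nat \<Rightarrow> nat" where
  "zero_extend xs i = (if i < length xs then xs ! i else 0)"

text \<open>
  \<open>exec P c (l, m) t (l', m')\<close>: started with local variables \<open>l\<close> and memory \<open>m\<close>, the command
  \<open>c\<close> terminates after \<open>t\<close> steps with \<open>l'\<close> and \<open>m'\<close>.  A procedure receives its arguments in
  the local variables \<open>0, 1, \<dots>\<close> and returns the final value of its local variable \<open>0\<close>;
  memory is global.
\<close>

inductive exec ::
  "program \<Rightarrow> com \<Rightarrow> (nat \<Rightarrow> nat) \<times> (nat \<Rightarrow> nat) \<Rightarrow> nat \<Rightarrow> (nat \<Rightarrow> nat) \<times> (nat \<Rightarrow> nat) \<Rightarrow> bool"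
  for P :: program
where
  Skip: "exec P Skip (l, m) 1 (l, m)"
| Assign: "exec P (Assign x e) (l, m) (1 + cost e) (l(x := eval e l m), m)"
| Store: "exec P (Store a e) (l, m) (1 + cost a + cost e) (l, m(eval a l m := eval e l m))"
| Seq: "exec P c1 s t1 s' \<Longrightarrow> exec P c2 s' t2 s'' \<Longrightarrow> exec P (Seq c1 c2) s (t1 + t2) s''"
| IfTrue: "eval b l m \<noteq> 0 \<Longrightarrow> exec P c1 (l, m) t s
    \<Longrightarrow> exec P (If b c1 c2) (l, m) (1 + cost b + t) s"
| IfFalse: "eval b l m = 0 \<Longrightarrow> exec P c2 (l, m) t s
    \<Longrightarrow> exec P (If b c1 c2) (l, m) (1 + cost b + t) s"
| WhileFalse: "eval b l m = 0 \<Longrightarrow> exec P (While b c) (l, m) (1 + cost b) (l, m)"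
| WhileTrue: "eval b l m \<noteq> 0 \<Longrightarrow> exec P c (l, m) t1 s \<Longrightarrow> exec P (While b c) s t2 s'
    \<Longrightarrow> exec P (While b c) (l, m) (1 + cost b + t1 + t2) s'"
| Call: "p < length P
    \<Longrightarrow> exec P (P ! p) (zero_extend (map (\<lambda>e. eval e l m) es), m) t (l', m')
    \<Longrightarrow> exec P (Call x p es) (l, m) (1 + sum_list (map cost es) + t) (l(x := l' 0), m')"

inductive_cases exec_SkipE: "exec P Skip s t s'"
inductive_cases exec_AssignE: "exec P (Assign x e) s t s'"
inductive_cases exec_StoreE: "exec P (Store a e) s t s'"
inductive_cases exec_SeqE: "exec P (Seq c1 c2) s t s'"
inductive_cases exec_IfE: "exec P (If b c1 c2) s t s'"
inductive_cases exec_WhileE: "exec P (While b c) s t s'"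
inductive_cases exec_CallE: "exec P (Call x p es) s t s'"

lemma exec_deterministic:
  "exec P c s t s' \<Longrightarrow> exec P c s u s'' \<Longrightarrow> t = u \<and> s' = s''"
proof (induction arbitrary: u s'' rule: exec.induct)
  case (Skip l m)
  then show ?case by (auto elim: exec_SkipE)
next
  case (Assign x e l m)
  then show ?case by (auto elim: exec_AssignE)
next
  case (Store a e l m)
  then show ?case by (auto elim: exec_StoreE)
next
  case (Seq c1 s t1 s1 c2 t2 s2)
  from Seq.prems show ?case
  proof (rule exec_SeqE, goal_cases)
    case (1 t3 s3 t4)
    have "t1 = t3" "s1 = s3"
      using Seq.IH(1)[OF 1(2)] by auto
    then show ?case
      using Seq.IH(2)[of t4 s''] 1 by simp
  qed
next
  case (IfTrue b l m c1 t s c2)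
  from IfTrue.prems show ?case
  proof (rule exec_IfE, goal_cases)
    case (1 l1 m1 t1)
    then show ?case
      using IfTrue.IH[of t1 s''] by simp
  next
    case (2 l1 m1 t1)
    then show ?case
      using IfTrue.hyps by simp
  qed
next
  case (IfFalse b l m c2 t s c1)
  from IfFalse.prems show ?case
  proof (rule exec_IfE, goal_cases)
    case (1 l1 m1 t1)
    then show ?case
      using IfFalse.hyps by simp
  next
    case (2 l1 m1 t1)
    then show ?case
      using IfFalse.IH[of t1 s''] by simp
  qed
next
  case (WhileFalse b l m c)
  from WhileFalse.prems show ?case
    by (rule exec_WhileE) (use WhileFalse.hyps in auto)
next
  case (WhileTrue b l m c t1 s t2 s')
  from WhileTrue.prems show ?case
  proof (rule exec_WhileE, goal_cases)
    case 1
    then show ?case using WhileTrue.hyps by simp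
  next
    case (2 l1 m1 t3 s3 t4)
    then have "t1 = t3" "s = s3"
      using WhileTrue.IH(1)[of t3 s3] by auto
    then show ?case
      using WhileTrue.IH(2)[of t4 s''] 2 by simp
  qed
next
  case (Call p l m es t l' m' x)
  from Call.prems show ?case
  proof (rule exec_CallE, goal_cases)
    case (1 l1 m1 t1 l2 m2)
    then show ?case
      using Call.IH[of t1 "(l2, m2)"] by simp
  qed
qed

text \<open>Execution starts with procedure \<open>0\<close>.\<close>

definition runs :: "program \<Rightarrow> (nat \<Rightarrow> nat) \<Rightarrow> nat \<Rightarrow> (nat \<Rightarrow> nat) \<Rightarrow> bool" where
  "runs P m t m' \<longleftrightarrow> P \<noteq> [] \<and> (\<exists>l'. exec P (P ! 0) (\<lambda>_. 0, m) t (l', m'))"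

text \<open>
  Initial memory for a graph with vertices \<open>0, \<dots>, n - 1\<close>: the number \<open>n\<close>, the \<open>n\<close> weights,
  and the adjacency matrix row by row.
\<close>

definition input_memory :: "nat graph \<Rightarrow> (nat \<Rightarrow> nat) \<Rightarrow> nat \<Rightarrow> nat" where
  "input_memory G w =
     (let n = card (verts G) in
      zero_extend (n # map w [0..<n] @
        map (\<lambda>i. of_bool ((i div n, i mod n) \<in> edges G)) [0..<n * n]))"

text \<open>In the final memory, cell \<open>0\<close> holds the neighbor-depth, and the cells \<open>v + 1\<close> hold the
  characteristic vector of the independent set.\<close>

definition output_nd :: "(nat \<Rightarrow> nat) \<Rightarrow> nat" where
  "output_nd m = m 0"

definition output_set :: "nat graph \<Rightarrow> (nat \<Rightarrow> nat) \<Rightarrow> nat set" where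
  "output_set G m = {v \<in> verts G. m (Suc v) \<noteq> 0}"

end

(*
  A connected graph has neighbor-depth at most k iff some vertex v leaves neighbor-depth less than k
  after deleting N[v] and at most k after deleting v.  Since neighbor-depth is monotone under
  induced subgraphs, any v with the first property may be chosen greedily.  On a vertex set S that
  need not be connected the same holds with the component C of v in S: test nd(C - N[v]) < k by
  recursion on k, then continue with S - v.  Hence there are at most n deletions per level, each
  preceded by at most n recursive tests, which gives n^O(k) calls.

  An optimal independent set I of S - v extends to S: there are no edges between C and S - C, so
  either I is optimal for S, or the part of I inside C is replaced by v together with an optimal
  set J of C - N[v].

  The program represents vertex sets by bit masks, so that all procedures except the final output
  loop are functions of their arguments that leave the memory unchanged.
*)
theory Submission
  imports Defs "HOL-Library.Nat_Bijection"
begin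

section \<open>Neighbor-depth of induced subgraphs\<close>

text \<open>The definition of neighbor-depth branches over components as well as over two deletions,
  so following it literally produces a tree of subproblems that is awkward to bound. Keeping
  \<open>S\<close> whole, and splitting off a component only where \<open>N[v]\<close> is deleted,
  turns the deletions at one threshold into a single chain of length at most \<open>n\<close>; every
  other branch lowers the threshold. Apart from the polynomial work of one level, each threshold
  then costs a factor of order n^2, which makes the exponent linear in \<open>k\<close>. The price
  is that the clause for connected graphs has to be transferred to arbitrary \<open>S\<close>;
  \<open>nd_induced_leI\<close> and \<open>nd_induced_leD\<close> do this.

  The solver decides a threshold instead of computing the exact depth, so the height of its
  recursion over thresholds is known in advance. The exact depth is found by raising the threshold
  from 0, hence no call ever works with a threshold above the true one.

  Because execution is deterministic, a procedure that restores the memory has a well-defined result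
  and time. Correctness and running time are therefore proved together, by one symbolic evaluation
  of each procedure body.\<close>

lemma induced_induced: "induced (induced G A) B = induced G (A \<inter> B)"
  by (auto simp: induced_def)

lemma induced_superset: "simple_graph G \<Longrightarrow> verts G \<subseteq> S \<Longrightarrow> induced G S = G"
  by (cases G) (auto simp: induced_def simple_graph_def)

lemma del_verts_eq: "simple_graph G \<Longrightarrow> del_verts G X = induced G (- X)"
  by (auto simp: induced_def del_verts_def simple_graph_def)

lemma sym_edges_rtrancl: "simple_graph G \<Longrightarrow> sym ((edges G)\<^sup>*)"
  by (simp add: simple_graph_def sym_rtrancl)

lemma components_connected:
  assumes "simple_graph G" "connected_graph G" "verts G \<noteq> {}"
  shows "components G = {verts G}"
  using assms by (force simp: components_def connected_graph_def)

lemma component_subset: "C \<in> components G \<Longrightarrow> C \<subseteq> verts G"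
  by (auto simp: components_def)

lemma component_nonempty: "C \<in> components G \<Longrightarrow> C \<noteq> {}"
  by (auto simp: components_def)

text \<open>A path that starts in \<open>C\<close> never leaves \<open>C\<close>, so all its edges
  survive in \<open>induced G C\<close>; paths between two arbitrary vertices go through
  \<open>v\<close> by symmetry.\<close>

lemma component_connected:
  assumes G: "simple_graph G" and C: "C \<in> components G"
  shows "connected_graph (induced G C)"
proof -
  obtain v where v: "v \<in> verts G" "C = {u \<in> verts G. (v, u) \<in> (edges G)\<^sup>*}"
    using C by (auto simp: components_def)
  have *: "(v, u) \<in> (edges G \<inter> C \<times> C)\<^sup>*" if "(v, u) \<in> (edges G)\<^sup>*" for u
    using that
  proof (induction rule: rtrancl_induct)
    case (step x y)
    have "(v, y) \<in> (edges G)\<^sup>*"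
      using step(1,2) by simp
    with step have "(x, y) \<in> edges G \<inter> C \<times> C"
      using G by (auto simp: v simple_graph_def)
    with step.IH show ?case by (rule rtrancl_into_rtrancl)
  qed simp
  have "sym ((edges G \<inter> C \<times> C)\<^sup>*)"
    using sym_edges_rtrancl[OF simple_graph_induced[OF G, of C]] by simp
  moreover have "(v, u) \<in> (edges G \<inter> C \<times> C)\<^sup>*" if "u \<in> C" for u
    using that * v by simp
  ultimately show ?thesis
    unfolding connected_graph_def verts_induced edges_induced
    by (metis IntD2 rtrancl_trans symD)
qed

text \<open>Treats empty, connected and disconnected graphs uniformly, so that upper bounds need to
  be shown for connected pieces only.\<close>

lemma nd_le_componentsI:
  assumes "simple_graph G" and le: "\<And>C. C \<in> components G \<Longrightarrow> nd (induced G C) \<le> k"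
  shows "nd G \<le> k"
proof (cases "verts G = {}")
  case True
  then show ?thesis using assms nd_eq_0_iff by fastforce
next
  case ne: False
  show ?thesis
  proof (cases "connected_graph G")
    case True
    then show ?thesis
      using le components_connected[OF assms(1) True ne] induced_superset[OF assms(1)] by force
  next
    case False
    have "finite (components G)" "components G \<noteq> {}"
      using assms(1) ne by (auto simp: components_def simple_graph_def)
    then show ?thesis
      unfolding nd_disconnected[OF assms(1) False] using le by simp
  qed
qed

lemma nd_component_le:
  assumes "simple_graph G" and "C \<in> components G"
  shows "nd (induced G C) \<le> nd G"
proof (cases "connected_graph G")
  case True
  moreover have "verts G \<noteq> {}"
    using assms(2) by (auto simp: components_def)
  ultimately show ?thesis
    using assms components_connected induced_superset by (metis order_refl singletonD)
next
  case False
  have "finite (components G)"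
    using assms by (auto simp: components_def simple_graph_def)
  then show ?thesis
    unfolding nd_disconnected[OF assms(1) False] using assms by simp
qed

text \<open>By induction on the number of vertices, for one component \<open>D\<close> of the
  subgraph at a time. If \<open>G\<close> is disconnected, \<open>D\<close> lies in a smaller
  component of \<open>G\<close>. Otherwise take the vertex \<open>v\<close> that witnesses
  \<open>nd G\<close>: either \<open>D\<close> avoids \<open>v\<close> and survives in
  \<open>G\<close> minus \<open>v\<close>, or \<open>v\<close> witnesses the same bound for
  \<open>D\<close>.\<close>

lemma nd_induced_le:
  assumes "simple_graph G"
  shows "nd (induced G S) \<le> nd G"
  using assms
proof (induction "card (verts G)" arbitrary: G S rule: less_induct)
  case less
  note G = less.prems
  have fin: "finite (verts G)"
    using G by (simp add: simple_graph_def)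
  have IH: "nd (induced (induced G A) B) \<le> nd (induced G A)" if "verts G \<inter> A \<noteq> verts G" for A B
    using less.hyps[of "induced G A" B] G simple_graph_induced fin that
    by (auto intro!: psubset_card_mono)
  show ?case
  proof (rule nd_le_componentsI[OF simple_graph_induced[OF G]])
    fix D assume D: "D \<in> components (induced G S)"
    have sub: "D \<subseteq> verts G" "D \<subseteq> S"
      using component_subset[OF D] by auto
    obtain x where x: "x \<in> D"
      using component_nonempty[OF D] by auto
    have K: "induced (induced G S) D = induced G D"
      using sub by (simp add: induced_induced Int_absorb1)
    have conn: "connected_graph (induced G D)"
      using component_connected[OF simple_graph_induced[OF G] D] by (simp add: K)
    have "nd (induced G D) \<le> nd G"
    proof (cases "connected_graph G")
      case False
      define C where "C = {u \<in> verts G. (x, u) \<in> (edges G)\<^sup>*}"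
      have C: "C \<in> components G"
        using x sub by (auto simp: C_def components_def)
      have "D \<subseteq> C"
      proof
        fix y assume "y \<in> D"
        then have "(x, y) \<in> (edges G \<inter> D \<times> D)\<^sup>*"
          using conn x sub by (auto simp: connected_graph_def)
        then show "y \<in> C"
          using \<open>y \<in> D\<close> sub rtrancl_mono[of "edges G \<inter> D \<times> D" "edges G"] by (auto simp: C_def)
      qed
      then have "induced G D = induced (induced G C) D"
        by (simp add: induced_induced Int_absorb1)
      also have "nd \<dots> \<le> nd (induced G C)"
        using component_psubset[OF G False C] by (intro IH) auto
      also have "\<dots> \<le> nd G"
        by (rule nd_component_le[OF G C])
      finally show ?thesis .
    next
      case True
      have "verts G \<noteq> {}"
        using x sub by auto
      then obtain v where v: "v \<in> verts G" "nd (del_verts G (closed_nbhd G v)) < nd G"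
          "nd (del_verts G {v}) \<le> nd G"
        using nd_connected_le_iff[OF G _ True, of "nd G"] by auto
      have 1: "nd (induced G (- {v} \<inter> D)) \<le> nd G"
      proof -
        have "verts G \<inter> - {v} \<noteq> verts G" using v(1) by blast
        from IH[OF this, of D] v(3) show ?thesis
          using G by (simp add: induced_induced del_verts_eq)
      qed
      have 2: "nd (induced G (- closed_nbhd G v \<inter> D)) < nd G"
      proof -
        have "verts G \<inter> - closed_nbhd G v \<noteq> verts G" using v(1) by (auto simp: closed_nbhd_def)
        from IH[OF this, of D] v(2) show ?thesis
          using G by (simp add: induced_induced del_verts_eq)
      qed
      show ?thesis
      proof (cases "v \<in> D")
        case False
        then have "- {v} \<inter> D = D" by auto
        with 1 show ?thesis by simp
      next
        case True
        have "D \<inter> - closed_nbhd (induced G D) v = - closed_nbhd G v \<inter> D"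
          using True by (auto simp: closed_nbhd_def)
        then have "nd (del_verts (induced G D) (closed_nbhd (induced G D) v)) < nd G"
            "nd (del_verts (induced G D) {v}) \<le> nd G"
          using 1 2 by (simp_all add: del_verts_eq simple_graph_induced G induced_induced Int_commute)
        moreover have "v \<in> verts (induced G D)"
          using True sub by auto
        ultimately show ?thesis
          using nd_connected_le_iff[OF simple_graph_induced[OF G] _ conn, of "nd G"] by blast
      qed
    qed
    then show "nd (induced (induced G S) D) \<le> nd G"
      by (simp add: K)
  qed
qed

lemma nd_mono:
  assumes "simple_graph G" "A \<subseteq> B"
  shows "nd (induced G A) \<le> nd (induced G B)"
  using nd_induced_le[OF simple_graph_induced[OF assms(1)], of B A] assms(2)
  by (simp add: induced_induced Int_absorb1)

section \<open>Components inside a vertex set, and the recursion for sets that need not be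
  connected\<close>

definition component :: "'a graph \<Rightarrow> 'a set \<Rightarrow> 'a \<Rightarrow> 'a set" where
  "component G S v = {u. (v, u) \<in> (edges G \<inter> S \<times> S)\<^sup>*}"

lemma component_self: "v \<in> component G S v"
  by (simp add: component_def)

lemma component_subset':
  assumes "v \<in> S"
  shows "component G S v \<subseteq> S"
proof
  fix u assume "u \<in> component G S v"
  then show "u \<in> S"
    unfolding component_def mem_Collect_eq by (cases rule: rtrancl.cases) (use assms in auto)
qed

lemma component_closed:
  assumes "simple_graph G" "v \<in> S" "x \<in> component G S v" "y \<in> S" "(x, y) \<in> edges G \<or> (y, x) \<in> edges G"
  shows "y \<in> component G S v"
proof -
  have "(x, y) \<in> edges G \<inter> S \<times> S"
    using assms component_subset'[OF assms(2)] by (auto simp: simple_graph_def sym_def)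
  with assms(3) show ?thesis
    unfolding component_def mem_Collect_eq by (rule rtrancl_into_rtrancl)
qed

lemma components_induced:
  assumes "S \<subseteq> verts G"
  shows "components (induced G S) = component G S ` S"
proof -
  have "{u \<in> S. (v, u) \<in> (edges G \<inter> S \<times> S)\<^sup>*} = component G S v" if "v \<in> S" for v
    using component_subset'[OF that, of G] by (auto simp: component_def)
  moreover have "verts G \<inter> S = S" using assms by auto
  ultimately show ?thesis
    by (simp add: components_def)
qed

lemma component_eq:
  assumes "simple_graph G" "x \<in> component G S v"
  shows "component G S x = component G S v"
proof -
  have "sym ((edges G \<inter> S \<times> S)\<^sup>*)"
    using sym_edges_rtrancl[OF simple_graph_induced[OF assms(1), of S]] by simp
  then show ?thesis
    using assms(2) unfolding component_def by (auto dest: symD intro: rtrancl_trans)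
qed

text \<open>A component of \<open>S\<close> without \<open>v\<close> is contained in
  \<open>S - {v}\<close>, so monotonicity and the second bound cover it. For the component that
  contains \<open>v\<close>, both bounds together are the clause for connected graphs with witness
  \<open>v\<close>.\<close>

lemma nd_induced_leI:
  assumes G: "simple_graph G" and S: "S \<subseteq> verts G" "v \<in> S"
    and 1: "nd (induced G (component G S v - closed_nbhd G v)) < k"
    and 2: "nd (induced G (S - {v})) \<le> k"
  shows "nd (induced G S) \<le> k"
proof (rule nd_le_componentsI[OF simple_graph_induced[OF G]])
  fix D assume D: "D \<in> components (induced G S)"
  then obtain x where x: "x \<in> S" "D = component G S x"
    using S by (auto simp: components_induced)
  have sub: "D \<subseteq> S"
    using component_subset'[OF x(1)] x by simp
  have K: "induced (induced G S) D = induced G D"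
    using sub by (simp add: induced_induced Int_absorb1)
  show "nd (induced (induced G S) D) \<le> k"
    unfolding K
  proof (cases "v \<in> D")
    case False
    then have "nd (induced G D) \<le> nd (induced G (S - {v}))"
      using sub by (intro nd_mono G) auto
    with 2 show "nd (induced G D) \<le> k" by simp
  next
    case True
    then have DC: "D = component G S v"
      using x component_eq[OF G] by metis
    have conn: "connected_graph (induced G D)"
      using component_connected[OF simple_graph_induced[OF G] D] by (simp add: K)
    have "D \<inter> - closed_nbhd (induced G D) v = D - closed_nbhd G v"
      using True by (auto simp: closed_nbhd_def)
    then have "nd (del_verts (induced G D) (closed_nbhd (induced G D) v)) < k"
      using 1 by (simp add: del_verts_eq simple_graph_induced G induced_induced DC)
    moreover have "nd (induced G (D \<inter> - {v})) \<le> nd (induced G (S - {v}))"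
      using sub by (intro nd_mono G) auto
    then have "nd (del_verts (induced G D) {v}) \<le> k"
      using 2 by (simp add: del_verts_eq simple_graph_induced G induced_induced)
    moreover have "v \<in> verts (induced G D)"
      using True S by auto
    ultimately show "nd (induced G D) \<le> k"
      using nd_connected_le_iff[OF simple_graph_induced[OF G] _ conn, of k] by blast
  qed
qed

text \<open>The witness of any single component \<open>D\<close> serves, because the component of
  each of its vertices in \<open>S\<close> is \<open>D\<close> again. This is what allows the solver
  to give up when no vertex passes the test.\<close>

lemma nd_induced_leD:
  assumes G: "simple_graph G" and S: "S \<subseteq> verts G" "S \<noteq> {}"
    and le: "nd (induced G S) \<le> k"
  shows "\<exists>v\<in>S. nd (induced G (component G S v - closed_nbhd G v)) < k"
proof -
  obtain x where x: "x \<in> S" using S by auto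
  define D where "D = component G S x"
  have D: "D \<in> components (induced G S)"
    using x S by (auto simp: components_induced D_def)
  have sub: "D \<subseteq> S"
    using component_subset'[OF x(1)] by (simp add: D_def)
  have K: "induced (induced G S) D = induced G D"
    using sub by (simp add: induced_induced Int_absorb1)
  have conn: "connected_graph (induced G D)"
    using component_connected[OF simple_graph_induced[OF G] D] by (simp add: K)
  have "nd (induced G D) \<le> k"
    using nd_component_le[OF simple_graph_induced[OF G] D] le by (simp add: K)
  moreover have "verts (induced G D) \<noteq> {}"
    using component_self[of x G S] sub S x by (auto simp: D_def)
  ultimately obtain v where v: "v \<in> D"
      "nd (del_verts (induced G D) (closed_nbhd (induced G D) v)) < k"
    using nd_connected_le_iff[OF simple_graph_induced[OF G] _ conn, of k] by auto
  have "D \<inter> - closed_nbhd (induced G D) v = D - closed_nbhd G v"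
    using v by (auto simp: closed_nbhd_def)
  then have "nd (induced G (component G S v - closed_nbhd G v)) < k"
    using v component_eq[OF G, of v S x]
    by (simp add: del_verts_eq simple_graph_induced G induced_induced D_def)
  then show ?thesis using v sub by auto
qed

text \<open>Since no edge joins \<open>C\<close> to \<open>S - C\<close>, parts inside and outside
  \<open>C\<close> can be exchanged freely. So \<open>I - C\<close> is optimal outside
  \<open>C\<close>, and \<open>C \<inter> I\<close> is optimal among the sets in \<open>C\<close>
  that avoid \<open>v\<close>, while \<open>insert v J\<close> is optimal among those that contain
  \<open>v\<close>. Only the weights inside \<open>C\<close> need to be compared.\<close>

lemma max_weight_independent_extend:
  assumes G: "simple_graph G" and S: "S \<subseteq> verts G" "v \<in> S"
    and C: "C = component G S v"
    and I: "max_weight_independent (induced G (S - {v})) w I"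
    and J: "max_weight_independent (induced G (C - closed_nbhd G v)) w J"
  shows "max_weight_independent (induced G S) w
           (if sum w (C \<inter> I) < sum w (insert v J) then (I - C) \<union> insert v J else I)"
proof -
  have CS: "C \<subseteq> S" "v \<in> C"
    using component_subset'[OF S(2)] component_self[of v G S] by (auto simp: C)
  have fin: "finite S"
    using S G finite_subset by (auto simp: simple_graph_def)
  have sym: "(a, b) \<in> edges G \<longleftrightarrow> (b, a) \<in> edges G" for a b
    using G by (auto simp: simple_graph_def sym_def)
  have irr: "(a, a) \<notin> edges G" for a
    using G by (auto simp: simple_graph_def irrefl_def)
  have indep: "independent (induced G A) T \<longleftrightarrow> T \<subseteq> A \<and> (\<forall>a\<in>T. \<forall>b\<in>T. (a, b) \<notin> edges G)"
    if "A \<subseteq> S" for A T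
  proof -
    have "verts G \<inter> A = A" using that S by blast
    then show ?thesis unfolding independent_def by auto
  qed
  have sep: "(a, b) \<notin> edges G" if "a \<in> C" "b \<in> S - C" for a b
    using component_closed[OF G S(2), of a b] that by (auto simp: C)
  have cross: "\<forall>a\<in>A \<union> B. \<forall>b\<in>A \<union> B. (a, b) \<notin> edges G"
    if "A \<subseteq> S - C" "B \<subseteq> C" "\<forall>a\<in>A. \<forall>b\<in>A. (a, b) \<notin> edges G" "\<forall>a\<in>B. \<forall>b\<in>B. (a, b) \<notin> edges G" for A B
    using that sep sym by (metis Un_iff subsetD)
  have I1: "I \<subseteq> S - {v}" "\<forall>a\<in>I. \<forall>b\<in>I. (a, b) \<notin> edges G"
    using I indep[of "S - {v}" I] by (auto simp: max_weight_independent_def)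
  have I2: "sum w T \<le> sum w I" if "T \<subseteq> S - {v}" "\<forall>a\<in>T. \<forall>b\<in>T. (a, b) \<notin> edges G" for T
    using I indep[of "S - {v}" T] that by (auto simp: max_weight_independent_def)
  have J1: "J \<subseteq> C - closed_nbhd G v" "\<forall>a\<in>J. \<forall>b\<in>J. (a, b) \<notin> edges G"
    using J indep[of "C - closed_nbhd G v" J] CS by (auto simp: max_weight_independent_def)
  have J2: "sum w T \<le> sum w J"
    if "T \<subseteq> C - closed_nbhd G v" "\<forall>a\<in>T. \<forall>b\<in>T. (a, b) \<notin> edges G" for T
  proof -
    have "C - closed_nbhd G v \<subseteq> S" using CS by blast
    then show ?thesis
      using J indep[of "C - closed_nbhd G v" T] that by (auto simp: max_weight_independent_def)
  qed
  have finI: "finite I" "finite J" "finite C"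
    using I1(1) J1(1) CS fin by (meson finite_subset finite_Diff)+
  have split: "sum w T = sum w (T - C) + sum w (C \<inter> T)" if "finite T" for T
    using sum.Int_Diff[OF that, of w C] by (simp add: Int_commute add.commute)
  let ?I = "if sum w (C \<inter> I) < sum w (insert v J) then (I - C) \<union> insert v J else I"
  have wI: "sum w ?I = sum w (I - C) + max (sum w (C \<inter> I)) (sum w (insert v J))"
  proof -
    have "sum w ((I - C) \<union> insert v J) = sum w (I - C) + sum w (insert v J)"
      using finI J1(1) CS by (intro sum.union_disjoint) auto
    then show ?thesis
      using split[OF finI(1)] by simp
  qed
  have "independent (induced G S) ?I"
  proof -
    have "insert v J \<subseteq> C" using J1 CS by blast
    moreover have "\<forall>a\<in>insert v J. \<forall>b\<in>insert v J. (a, b) \<notin> edges G"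
      using J1 irr sym by (auto simp: closed_nbhd_def)
    ultimately have "\<forall>a\<in>(I - C) \<union> insert v J. \<forall>b\<in>(I - C) \<union> insert v J. (a, b) \<notin> edges G"
      using I1 by (intro cross) blast+
    then show ?thesis
      using I1 \<open>insert v J \<subseteq> C\<close> CS unfolding indep[OF order_refl] by auto
  qed
  moreover have "sum w T \<le> sum w ?I" if "independent (induced G S) T" for T
  proof -
    have T: "T \<subseteq> S" "\<forall>a\<in>T. \<forall>b\<in>T. (a, b) \<notin> edges G"
      using that indep[of S T] by auto
    have finT: "finite T"
      by (rule finite_subset[OF T(1) fin])
    \<comment> \<open>Exchange outside \<open>C\<close>: the inner part is taken from
      \<open>I\<close>, which avoids \<open>v\<close>, so the mixture competes with \<open>I\<close>
      in \<open>S - {v}\<close> even when \<open>T\<close> contains \<open>v\<close>.\<close>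
    have "sum w ((T - C) \<union> (C \<inter> I)) \<le> sum w I"
    proof (intro I2 cross)
      show "T - C \<union> C \<inter> I \<subseteq> S - {v}" using T I1 CS by blast
    qed (use T I1 in blast)+
    moreover have "sum w ((T - C) \<union> (C \<inter> I)) = sum w (T - C) + sum w (C \<inter> I)"
      using finT finI by (intro sum.union_disjoint) auto
    ultimately have A: "sum w (T - C) \<le> sum w (I - C)"
      using split[OF finI(1)] by linarith
    have B: "sum w (C \<inter> T) \<le> max (sum w (C \<inter> I)) (sum w (insert v J))"
    proof (cases "v \<in> T")
      case True
      have vJ: "v \<notin> J" using J1(1) by (auto simp: closed_nbhd_def)
      have "sum w (C \<inter> T - {v}) \<le> sum w J"
        using T True by (intro J2) (auto simp: closed_nbhd_def)
      then have "sum w (C \<inter> T) \<le> sum w (insert v J)"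
        using True CS finT finI vJ by (subst sum.remove[of _ v]) auto
      then show ?thesis by simp
    next
      case False
      have "sum w ((I - C) \<union> (C \<inter> T)) \<le> sum w I"
      proof (intro I2 cross)
        show "I - C \<union> C \<inter> T \<subseteq> S - {v}" using T I1 CS False by blast
      qed (use T I1 in blast)+
      moreover have "sum w ((I - C) \<union> (C \<inter> T)) = sum w (I - C) + sum w (C \<inter> T)"
        using finT finI by (intro sum.union_disjoint) auto
      ultimately show ?thesis
        using split[OF finI(1)] by linarith
    qed
    show ?thesis
      using A B split[OF finT] by (simp only: wI)
  qed
  ultimately show ?thesis
    by (simp add: max_weight_independent_def)
qed

section \<open>Weakest preconditions with exact running time\<close>

text \<open>The argument \<open>a\<close> is the time spent so far; the postcondition receives the total.  Because
  execution is deterministic, \<open>wp\<close> can be characterised by equations, which the simplifier runs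
  as a symbolic evaluator.\<close>

definition wp :: "program \<Rightarrow> com \<Rightarrow> (nat \<Rightarrow> nat) \<Rightarrow> (nat \<Rightarrow> nat) \<Rightarrow> nat
    \<Rightarrow> ((nat \<Rightarrow> nat) \<Rightarrow> (nat \<Rightarrow> nat) \<Rightarrow> nat \<Rightarrow> bool) \<Rightarrow> bool" where
  "wp P c l m a Q \<longleftrightarrow> (\<exists>t l' m'. exec P c (l, m) t (l', m') \<and> Q l' m' (a + t))"

text \<open>The same \<open>m\<close> occurs before and after: only runs that restore the memory
  count, which is what makes \<open>result\<close> and \<open>time\<close> functions of the
  arguments and the memory.\<close>

definition halts :: "program \<Rightarrow> nat \<Rightarrow> nat list \<Rightarrow> (nat \<Rightarrow> nat) \<Rightarrow> bool" where
  "halts P p xs m \<longleftrightarrow> p < length P \<and> (\<exists>t l'. exec P (P ! p) (zero_extend xs, m) t (l', m))"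

definition result :: "program \<Rightarrow> nat \<Rightarrow> nat list \<Rightarrow> (nat \<Rightarrow> nat) \<Rightarrow> nat" where
  "result P p xs m = (THE r. \<exists>t l'. exec P (P ! p) (zero_extend xs, m) t (l', m) \<and> l' 0 = r)"

definition time :: "program \<Rightarrow> nat \<Rightarrow> nat list \<Rightarrow> (nat \<Rightarrow> nat) \<Rightarrow> nat" where
  "time P p xs m = (THE t. \<exists>l'. exec P (P ! p) (zero_extend xs, m) t (l', m))"

definition computes :: "program \<Rightarrow> nat \<Rightarrow> nat list \<Rightarrow> (nat \<Rightarrow> nat) \<Rightarrow> nat \<Rightarrow> nat \<Rightarrow> bool" where
  "computes P p xs m r T \<longleftrightarrow> halts P p xs m \<and> result P p xs m = r \<and> time P p xs m \<le> T"

lemma exec_result_time: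
  assumes "exec P (P ! p) (zero_extend xs, m) t (l', m)"
  shows "result P p xs m = l' 0" and "time P p xs m = t"
proof -
  have unique: "u = t \<and> k = l'" if "exec P (P ! p) (zero_extend xs, m) u (k, m)" for u k
    using exec_deterministic[OF assms that] by simp
  show "result P p xs m = l' 0" "time P p xs m = t"
    unfolding result_def time_def using assms unique by (blast intro: the_equality)+
qed

lemma wp_Skip [simp]: "wp P Skip l m a Q \<longleftrightarrow> Q l m (a + 1)"
  unfolding wp_def using exec.Skip exec_deterministic by blast

lemma wp_Assign [simp]: "wp P (Assign x e) l m a Q \<longleftrightarrow> Q (l(x := eval e l m)) m (a + (1 + cost e))"
  unfolding wp_def using exec.Assign exec_deterministic by blast

lemma wp_Store [simp]:
  "wp P (Store b e) l m a Q \<longleftrightarrow> Q l (m(eval b l m := eval e l m)) (a + (1 + cost b + cost e))"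
  unfolding wp_def using exec.Store exec_deterministic by blast

lemma wp_Seq [simp]:
  "wp P (Seq c1 c2) l m a Q \<longleftrightarrow> wp P c1 l m a (\<lambda>l m a. wp P c2 l m a Q)"
proof
  assume "wp P (Seq c1 c2) l m a Q"
  then show "wp P c1 l m a (\<lambda>l m a. wp P c2 l m a Q)"
    unfolding wp_def by (elim exE conjE exec_SeqE) (metis add.assoc surj_pair)
next
  assume "wp P c1 l m a (\<lambda>l m a. wp P c2 l m a Q)"
  then show "wp P (Seq c1 c2) l m a Q"
    unfolding wp_def by (elim exE conjE) (metis exec.Seq add.assoc)
qed

lemma wp_If [simp]:
  "wp P (If b c1 c2) l m a Q \<longleftrightarrow>
    (if eval b l m \<noteq> 0 then wp P c1 l m (a + (1 + cost b)) Q else wp P c2 l m (a + (1 + cost b)) Q)"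
proof -
  have "exec P (If b c1 c2) (l, m) t s \<longleftrightarrow> (\<exists>u. t = 1 + cost b + u \<and>
      exec P (if eval b l m \<noteq> 0 then c1 else c2) (l, m) u s)" for t s
    using exec.IfTrue[of b l m P c1 _ s c2] exec.IfFalse[of b l m P c2 _ s c1]
    by (auto elim!: exec_IfE)
  then show ?thesis
    unfolding wp_def by (cases "eval b l m = 0") (simp only: add.assoc if_True if_False simp_thms; blast)+
qed

text \<open>Not a simplification rule, since the loop reappears on the right; it is unfolded once
  per induction step by \<open>subst\<close>.\<close>

lemma wp_While:
  "wp P (While b c) l m a Q \<longleftrightarrow>
    (if eval b l m \<noteq> 0 then wp P c l m (a + (1 + cost b)) (\<lambda>l m a. wp P (While b c) l m a Q)
     else Q l m (a + (1 + cost b)))"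
proof -
  have iff: "exec P (While b c) (l, m) t s \<longleftrightarrow> (if eval b l m \<noteq> 0 then
      \<exists>u1 l1 m1 u2. t = 1 + cost b + u1 + u2 \<and> exec P c (l, m) u1 (l1, m1) \<and> exec P (While b c) (l1, m1) u2 s
      else t = 1 + cost b \<and> s = (l, m))" (is "?L \<longleftrightarrow> ?R") for t s
  proof
    assume ?L
    then show ?R by (rule exec_WhileE) fastforce+
  next
    assume ?R
    then show ?L
      using exec.WhileFalse[of b l m P c] exec.WhileTrue[of b l m P c] by (cases s) (auto split: if_splits)
  qed
  show ?thesis
  proof (cases "eval b l m = 0")
    case False
    then show ?thesis
      unfolding wp_def iff by (simp only: add.assoc simp_thms if_True) blast
  qed (simp add: wp_def iff)
qed

text \<open>A call becomes the opaque terms \<open>result\<close> and \<open>time\<close>. An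
  unfolded \<open>computes\<close> fact about the callee discharges the side condition, rewrites the
  first term and bounds the second, which is why the correctness proofs below all have the same
  shape.\<close>

lemma wp_Call [simp]:
  assumes "halts P p (map (\<lambda>e. eval e l m) es) m"
  shows "wp P (Call x p es) l m a Q \<longleftrightarrow>
    Q (l(x := result P p (map (\<lambda>e. eval e l m) es) m)) m
      (a + (1 + sum_list (map cost es) + time P p (map (\<lambda>e. eval e l m) es) m))"
proof -
  obtain t l' where p: "p < length P"
    and e: "exec P (P ! p) (zero_extend (map (\<lambda>e. eval e l m) es), m) t (l', m)"
    using assms unfolding halts_def by auto
  have "exec P (Call x p es) (l, m) u s \<longleftrightarrow>
      u = 1 + sum_list (map cost es) + t \<and> s = (l(x := l' 0), m)" for u s
    using exec.Call[OF p e] exec_deterministic by blast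
  then show ?thesis
    unfolding wp_def exec_result_time[OF e] by auto
qed

lemma wp_mono:
  "wp P c l m a Q \<Longrightarrow> (\<And>l m a. Q l m a \<Longrightarrow> Q' l m a) \<Longrightarrow> wp P c l m a Q'"
  unfolding wp_def by blast

lemma computesI:
  assumes "p < length P" "P ! p = c"
    and "wp P c (zero_extend xs) m 0 (\<lambda>l' m' t. m' = m \<and> l' 0 = r \<and> t \<le> T)"
  shows "computes P p xs m r T"
proof -
  obtain t l' where e: "exec P (P ! p) (zero_extend xs, m) t (l', m)" "l' 0 = r" "t \<le> T"
    using assms unfolding wp_def by auto
  show ?thesis
    using exec_result_time[OF e(1)] e assms(1) unfolding computes_def halts_def by auto
qed

lemma computes_mono: "computes P p xs m r T \<Longrightarrow> T \<le> T' \<Longrightarrow> computes P p xs m r T'"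
  by (auto simp: computes_def)

lemma zero_extend_Nil [simp]: "zero_extend [] i = 0"
  by (simp add: zero_extend_def)

lemma zero_extend_Cons [simp]: "zero_extend (x # xs) i = (if i = 0 then x else zero_extend xs (i - 1))"
  by (cases i) (auto simp: zero_extend_def)

section \<open>The program\<close>

text \<open>Opaque names for the procedure numbers keep the simplifier from evaluating calls.\<close>

definition "pow_proc = (1::nat)"
definition "rem_proc = (2::nat)"
definition "mem_proc = (3::nat)"
definition "mul_proc = (4::nat)"
definition "adj_proc = (5::nat)"
definition "nbr_proc = (6::nat)"
definition "nbrs_proc = (7::nat)"
definition "grow_proc = (8::nat)"
definition "step_proc = (9::nat)"
definition "iter_proc = (10::nat)"
definition "comp_proc = (11::nat)"
definition "far_proc = (12::nat)"
definition "rest_proc = (13::nat)"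
definition "wsum_proc = (14::nat)"
definition "pick_proc = (15::nat)"
definition "merge_proc = (16::nat)"
definition "solve_proc = (17::nat)"
definition "find_proc = (18::nat)"
definition "search_proc = (19::nat)"

definition pow_body :: com where
  "pow_body =
    If (Var 0)
      (Seq (Call 0 pow_proc [Minus (Var 0) (Const 1)])
           (Assign 0 (Plus (Var 0) (Var 0))))
      (Assign 0 (Const 1))"

text \<open>Without division, \<open>S mod p\<close> is obtained from \<open>S mod 2p\<close>, doubling \<open>p\<close> until it exceeds
  \<open>S\<close>; membership of \<open>v\<close> in a bit mask is then read off \<open>S mod 2^(v+1)\<close>.\<close>

definition rem_body :: com where
  "rem_body =
    If (Less (Var 0) (Var 1))
      Skip
      (Seq (Call 0 rem_proc [Var 0, Plus (Var 1) (Var 1)])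
           (If (Less (Var 0) (Var 1)) Skip (Assign 0 (Minus (Var 0) (Var 1)))))"

definition mem_body :: com where
  "mem_body =
    Seq (Call 2 pow_proc [Var 1])
   (Seq (Call 0 rem_proc [Var 0, Plus (Var 2) (Var 2)])
        (Assign 0 (Minus (Const 1) (Less (Var 0) (Var 2)))))"

definition mul_body :: com where
  "mul_body =
    If (Var 0)
      (Seq (Call 0 mul_proc [Minus (Var 0) (Const 1), Var 1])
           (Assign 0 (Plus (Var 0) (Var 1))))
      Skip"

text \<open>The address skips cell 0 and the \<open>n\<close> weights before entering the
  matrix.\<close>

definition adj_body :: com where
  "adj_body =
    Seq (Assign 2 (Mem (Const 0)))
   (Seq (Call 3 mul_proc [Var 0, Var 2])
        (Assign 0 (Mem (Plus (Plus (Const 1) (Var 2)) (Plus (Var 3) (Var 1))))))"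

text \<open>Set comprehension as a procedure scheme: it builds the mask of all \<open>u\<close>
  below the first argument that pass the test \<open>q\<close>. The number \<open>p\<close> is that
  of the procedure itself, for its recursive call; the other three arguments are handed on to
  \<open>q\<close>.\<close>

definition collect_body :: "nat \<Rightarrow> nat \<Rightarrow> com" where
  "collect_body p q =
    If (Var 0)
      (Seq (Assign 4 (Minus (Var 0) (Const 1)))
      (Seq (Call 5 q [Var 4, Var 1, Var 2, Var 3])
      (Seq (Call 0 p [Var 4, Var 1, Var 2, Var 3])
           (If (Var 5)
             (Seq (Call 6 pow_proc [Var 4]) (Assign 0 (Plus (Var 0) (Var 6))))
             Skip))))
      Skip"

definition nbr_body :: com where
  "nbr_body =
    Seq (Call 3 mem_proc [Var 1, Var 0])
        (If (Var 3) (Call 0 adj_proc [Var 0, Var 2]) (Assign 0 (Const 0)))"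

definition grow_body :: com where
  "grow_body =
    Seq (Call 3 mem_proc [Var 1, Var 0])
        (If (Var 3)
          (Assign 0 (Const 1))
          (Seq (Call 3 mem_proc [Var 2, Var 0])
               (If (Var 3)
                 (Call 0 nbrs_proc [Mem (Const 0), Var 1, Var 0, Const 0])
                 (Assign 0 (Const 0)))))"

definition iter_body :: com where
  "iter_body =
    If (Var 0)
      (Seq (Call 1 step_proc [Mem (Const 0), Var 1, Var 2, Const 0])
           (Call 0 iter_proc [Minus (Var 0) (Const 1), Var 1, Var 2]))
      (Assign 0 (Var 1))"

definition comp_body :: com where
  "comp_body =
    Seq (Call 2 mul_proc [Mem (Const 0), Mem (Const 0)])
   (Seq (Call 3 pow_proc [Var 1])
        (Call 0 iter_proc [Var 2, Var 3, Var 0]))"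

text \<open>Truncated subtraction serves as "and not"; the nested difference of the two comparisons
  is an equality test.\<close>

definition far_body :: com where
  "far_body =
    Seq (Call 3 mem_proc [Var 1, Var 0])
   (Seq (Call 4 adj_proc [Var 2, Var 0])
        (Assign 0 (Minus (Minus (Var 3) (Var 4))
           (Minus (Minus (Const 1) (Less (Var 0) (Var 2))) (Less (Var 2) (Var 0))))))"

text \<open>When the weight is read, variable 0 still holds \<open>Suc i\<close>, which is the
  address of the weight of vertex \<open>i\<close>.\<close>

definition wsum_body :: com where
  "wsum_body =
    If (Var 0)
      (Seq (Assign 3 (Minus (Var 0) (Const 1)))
      (Seq (Call 4 mem_proc [Var 1, Var 3])
      (Seq (Call 5 mem_proc [Var 2, Var 3])
      (Seq (Call 6 wsum_proc [Var 3, Var 1, Var 2])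
      (Seq (If (Var 4) (If (Var 5) (Assign 6 (Plus (Var 6) (Mem (Var 0)))) Skip) Skip)
           (Assign 0 (Var 6)))))))
      Skip"

definition pick_body :: com where
  "pick_body =
    Seq (Call 4 mem_proc [Var 1, Var 0])
        (If (Var 4) (Call 0 mem_proc [Var 3, Var 0]) (Call 0 mem_proc [Var 2, Var 0]))"

text \<open>A call with arguments \<open>S, k\<close> returns \<open>0\<close> if the neighbor-depth of \<open>S\<close> exceeds \<open>k\<close>, and
  otherwise one plus the mask of an optimal set; \<open>find_body\<close> likewise returns \<open>Suc v\<close> for a
  suitable vertex \<open>v\<close>, and \<open>0\<close> if there is none.\<close>

definition solve_body :: com where
  "solve_body =
    If (Var 0)
      (If (Var 1)
        (Seq (Call 2 find_proc [Mem (Const 0), Var 0, Var 1])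
          (If (Var 2)
            (Seq (Assign 2 (Minus (Var 2) (Const 1)))
            (Seq (Call 3 pow_proc [Var 2])
            (Seq (Call 4 solve_proc [Minus (Var 0) (Var 3), Var 1])
              (If (Var 4)
                (Seq (Call 5 comp_proc [Var 0, Var 2])
                (Seq (Call 6 rest_proc [Mem (Const 0), Var 5, Var 2, Const 0])
                (Seq (Call 7 solve_proc [Var 6, Minus (Var 1) (Const 1)])
                (Seq (Assign 8 (Plus (Var 3) (Minus (Var 7) (Const 1))))
                (Seq (Assign 9 (Minus (Var 4) (Const 1)))
                (Seq (Call 10 wsum_proc [Mem (Const 0), Var 5, Var 9])
                (Seq (Call 11 wsum_proc [Mem (Const 0), Var 8, Var 8])
                  (If (Less (Var 10) (Var 11))
                    (Seq (Call 0 merge_proc [Mem (Const 0), Var 5, Var 9, Var 8])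
                         (Assign 0 (Plus (Var 0) (Const 1))))
                    (Assign 0 (Var 4))))))))))
                (Assign 0 (Const 0))))))
            (Assign 0 (Const 0))))
        (Assign 0 (Const 0)))
      (Assign 0 (Const 1))"

definition find_body :: com where
  "find_body =
    If (Var 0)
      (Seq (Assign 3 (Minus (Var 0) (Const 1)))
      (Seq (Call 4 mem_proc [Var 1, Var 3])
      (Seq (If (Var 4)
             (Seq (Call 5 comp_proc [Var 1, Var 3])
             (Seq (Call 6 rest_proc [Mem (Const 0), Var 5, Var 3, Const 0])
                  (Call 4 solve_proc [Var 6, Minus (Var 2) (Const 1)])))
             Skip)
           (If (Var 4) Skip (Call 0 find_proc [Var 3, Var 1, Var 2])))))
      Skip"

text \<open>Thresholds are tried from below, so none beyond the true depth is ever paid for.\<close>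

definition search_body :: com where
  "search_body =
    Seq (Call 2 solve_proc [Var 1, Var 0])
        (If (Var 2) Skip (Call 0 search_proc [Plus (Var 0) (Const 1), Var 1]))"

definition write_body :: com where
  "write_body =
    Seq (Assign 4 (Minus (Var 0) (Const 1)))
   (Seq (Call 5 mem_proc [Var 3, Var 4])
   (Seq (Store (Var 0) (Var 5))
        (Assign 0 (Var 4))))"

text \<open>The output overwrites the weights and finally the cell of \<open>n\<close>, so depth and
  set are first held in local variables, the set as a mask. \<open>2 ^ n - 1\<close> is the mask of
  all vertices.\<close>

definition main_body :: com where
  "main_body =
    Seq (Assign 0 (Mem (Const 0)))
   (Seq (Call 1 pow_proc [Var 0])
   (Seq (Assign 1 (Minus (Var 1) (Const 1)))
   (Seq (Call 2 search_proc [Const 0, Var 1])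
   (Seq (Call 3 solve_proc [Var 1, Var 2])
   (Seq (Assign 3 (Minus (Var 3) (Const 1)))
   (Seq (While (Var 0) write_body)
        (Store (Const 0) (Var 2))))))))"

definition prog :: program where
  "prog =
    [main_body, pow_body, rem_body, mem_body, mul_body, adj_body,
     nbr_body, collect_body nbrs_proc nbr_proc, grow_body, collect_body step_proc grow_proc,
     iter_body, comp_body, far_body, collect_body rest_proc far_proc, wsum_body,
     pick_body, collect_body merge_proc pick_proc, solve_body, find_body, search_body]"

lemmas proc_defs = pow_proc_def rem_proc_def mem_proc_def mul_proc_def adj_proc_def nbr_proc_def
  nbrs_proc_def grow_proc_def step_proc_def iter_proc_def comp_proc_def far_proc_def rest_proc_def
  wsum_proc_def pick_proc_def merge_proc_def solve_proc_def find_proc_def search_proc_def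

lemma prog_nth:
  "prog ! 0 = main_body" "prog ! pow_proc = pow_body" "prog ! rem_proc = rem_body"
  "prog ! mem_proc = mem_body" "prog ! mul_proc = mul_body" "prog ! adj_proc = adj_body"
  "prog ! nbr_proc = nbr_body" "prog ! nbrs_proc = collect_body nbrs_proc nbr_proc"
  "prog ! grow_proc = grow_body" "prog ! step_proc = collect_body step_proc grow_proc"
  "prog ! iter_proc = iter_body" "prog ! comp_proc = comp_body" "prog ! far_proc = far_body"
  "prog ! rest_proc = collect_body rest_proc far_proc" "prog ! wsum_proc = wsum_body"
  "prog ! pick_proc = pick_body" "prog ! merge_proc = collect_body merge_proc pick_proc"
  "prog ! solve_proc = solve_body" "prog ! find_proc = find_body" "prog ! search_proc = search_body"
  unfolding prog_def by (simp_all add: proc_defs)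

lemma proc_less:
  "pow_proc < length prog" "rem_proc < length prog"
  "mem_proc < length prog" "mul_proc < length prog" "adj_proc < length prog"
  "nbr_proc < length prog" "nbrs_proc < length prog" "grow_proc < length prog"
  "step_proc < length prog" "iter_proc < length prog" "comp_proc < length prog"
  "far_proc < length prog" "rest_proc < length prog" "wsum_proc < length prog"
  "pick_proc < length prog" "merge_proc < length prog" "solve_proc < length prog"
  "find_proc < length prog" "search_proc < length prog"
  unfolding prog_def by (simp_all add: proc_defs)

section \<open>Correctness and running time of the procedures\<close>

lemma pow_correct: "computes prog pow_proc [i] m (2 ^ i) (20 * i + 20)"
proof (induction i)
  case 0
  show ?case
    by (rule computesI[OF proc_less(1) prog_nth(2)]) (simp add: pow_body_def)
next
  case (Suc i)
  then show ?case
    by (intro computesI[OF proc_less(1) prog_nth(2)]) (simp add: pow_body_def computes_def)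
qed

text \<open>\<open>j\<close> bounds the number of doublings before \<open>p\<close> exceeds
  \<open>S\<close>, hence the recursion depth. On the way back, the remainders modulo
  \<open>2p\<close> and modulo \<open>p\<close> differ by at most one subtraction of
  \<open>p\<close>.\<close>

lemma rem_correct:
  assumes "S < 2 ^ j * p" "p > 0"
  shows "computes prog rem_proc [S, p] m (S mod p) (20 * j + 20)"
  using assms
proof (induction j arbitrary: p)
  case 0
  then show ?case
    by (intro computesI[OF proc_less(2) prog_nth(3)]) (simp add: rem_body_def)
next
  case (Suc j)
  then have "computes prog rem_proc [S, p + p] m (S mod (p + p)) (20 * j + 20)"
    by (intro Suc.IH) (auto simp: algebra_simps)
  moreover have "S mod p = (if S mod (p + p) < p then S mod (p + p) else S mod (p + p) - p)"
  proof -
    have "S mod p = S mod (p + p) mod p"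
      by (metis mod_mod_cancel dvd_add_triv_left_iff dvd_refl)
    moreover have "S mod (p + p) < p + p" using Suc.prems by simp
    ultimately show ?thesis
      by (metis le_mod_geq linorder_not_less mod_less less_diff_conv2)
  qed
  ultimately obtain r where r: "computes prog rem_proc [S, p + p] m r (20 * j + 20)"
    "S mod p = (if r < p then r else r - p)"
    by blast
  show ?case
  proof (cases "S < p")
    case True
    then show ?thesis
      by (intro computesI[OF proc_less(2) prog_nth(3)]) (simp add: rem_body_def)
  next
    case False
    show ?thesis
      unfolding r(2) using r(1) False
      by (intro computesI[OF proc_less(2) prog_nth(3)]) (simp add: rem_body_def computes_def)
  qed
qed

lemma mul_correct: "computes prog mul_proc [a, b] m (a * b) (20 * a + 20)"
proof (induction a)
  case 0
  show ?case
    by (rule computesI[OF proc_less(4) prog_nth(5)]) (simp add: mul_body_def)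
next
  case (Suc i)
  then show ?case
    by (intro computesI[OF proc_less(4) prog_nth(5)]) (simp add: mul_body_def computes_def)
qed

section \<open>Vertex sets as bit masks\<close>

lemma set_encode_less:
  assumes "A \<subseteq> {..<n}"
  shows "set_encode A < 2 ^ n"
proof -
  have "set_encode A \<le> set_encode {..<n}"
    unfolding set_encode_def by (rule sum_mono2) (use assms in auto)
  also have "\<dots> = 2 ^ n - 1"
    unfolding set_encode_def using sum_power2[of n] by (simp add: atLeast0LessThan)
  also have "\<dots> < 2 ^ n"
    by simp
  finally show ?thesis .
qed

text \<open>The remainder is bit \<open>v\<close> times \<open>2 ^ v\<close> plus something below
  \<open>2 ^ v\<close>, so the comparison reads off that bit, in the form used by
  \<open>set_decode\<close>.\<close>

lemma mod_double_less_iff: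
  fixes S :: nat
  shows "S mod (2 ^ v + 2 ^ v) < 2 ^ v \<longleftrightarrow> even (S div 2 ^ v)"
proof -
  have "S mod (2 ^ v + 2 ^ v) = 2 ^ v * (S div 2 ^ v mod 2) + S mod 2 ^ v"
    using mod_mult2_eq[of S "2 ^ v" 2] by (simp add: mult_2_right)
  then show ?thesis
    by (cases "even (S div 2 ^ v)") (simp_all add: odd_iff_mod_2_eq_one even_iff_mod_2_eq_zero)
qed

lemma mem_correct:
  assumes "A \<subseteq> {..<n}" "v < n"
  shows "computes prog mem_proc [set_encode A, v] m (of_bool (v \<in> A)) (40 * n + 60)"
proof -
  let ?S = "set_encode A"
  have fin: "finite A" using assms(1) finite_subset by blast
  have "computes prog rem_proc [?S, 2 ^ v + 2 ^ v] m (?S mod (2 ^ v + 2 ^ v)) (20 * n + 20)"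
  proof (rule rem_correct)
    have "2 ^ n * 1 \<le> 2 ^ n * (2 ^ v + 2 ^ v :: nat)"
      by (intro mult_le_mono2) (use one_le_power[of "2::nat" v] in linarith)
    then show "?S < 2 ^ n * (2 ^ v + 2 ^ v)"
      using set_encode_less[OF assms(1)] by linarith
  qed simp
  moreover have "?S mod (2 ^ v + 2 ^ v) < 2 ^ v \<longleftrightarrow> v \<notin> A"
    using set_encode_inverse[OF fin] unfolding mod_double_less_iff set_decode_def by blast
  ultimately obtain r where "computes prog rem_proc [?S, 2 ^ v + 2 ^ v] m r (20 * n + 20)"
    "r < 2 ^ v \<longleftrightarrow> v \<notin> A"
    by blast
  then show ?thesis
    using assms(2) pow_correct[of v m]
    by (intro computesI[OF proc_less(3) prog_nth(4)]) (simp add: mem_body_def computes_def)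
qed

text \<open>Only whether \<open>r\<close> vanishes matters: a test may return any number, and
  \<open>grow_proc\<close> indeed returns a whole mask.\<close>

lemma collect_correct:
  assumes p: "p < length prog" "prog ! p = collect_body p q"
    and q: "\<And>u. u < n \<Longrightarrow> \<exists>r. computes prog q [u, a, b, c] m r T \<and> (r \<noteq> 0 \<longleftrightarrow> R u)"
    and i: "i \<le> n"
  shows "computes prog p [i, a, b, c] m (set_encode {u. u < i \<and> R u}) (i * (T + 20 * n + 60) + 20)"
  using i
proof (induction i)
  case 0
  show ?case
    by (rule computesI[OF p]) (simp add: collect_body_def)
next
  case (Suc i)
  then obtain r where r: "computes prog q [i, a, b, c] m r T" "r \<noteq> 0 \<longleftrightarrow> R i"
    using q[of i] by auto
  have *: "{u. u < Suc i \<and> R u} = (if R i then insert i {u. u < i \<and> R u} else {u. u < i \<and> R u})"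
    by (auto simp: less_Suc_eq)
  show ?case
    using Suc r pow_correct[of i m]
    by (intro computesI[OF p]) (simp add: collect_body_def computes_def *)
qed

lemma set_encode_eq_0: "finite A \<Longrightarrow> set_encode A = 0 \<longleftrightarrow> A = {}"
  using set_encode_eq[of A "{}"] by simp

text \<open>These bounds follow the call structure of the procedures, with constants rounded up
  generously; later only their polynomial growth counts.\<close>

definition time_mem :: "nat \<Rightarrow> nat" where
  "time_mem n = 40 * n + 60"
definition time_nbr :: "nat \<Rightarrow> nat" where
  "time_nbr n = time_mem n + 20 * n + 80"
definition time_nbrs :: "nat \<Rightarrow> nat" where
  "time_nbrs n = n * (time_nbr n + 20 * n + 60) + 20"
definition time_grow :: "nat \<Rightarrow> nat" where
  "time_grow n = 2 * time_mem n + time_nbrs n + 60"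
definition time_step :: "nat \<Rightarrow> nat" where
  "time_step n = n * (time_grow n + 20 * n + 60) + 20"
definition time_comp :: "nat \<Rightarrow> nat" where
  "time_comp n = n * n * (time_step n + 60) + 40 * n + 120"
definition time_rest :: "nat \<Rightarrow> nat" where
  "time_rest n = n * (2 * time_nbr n + 20 * n + 60) + 20"
definition time_wsum :: "nat \<Rightarrow> nat" where
  "time_wsum n = n * (2 * time_mem n + 80) + 20"
definition time_merge :: "nat \<Rightarrow> nat" where
  "time_merge n = n * (2 * time_mem n + 20 * n + 110) + 20"
definition time_level :: "nat \<Rightarrow> nat" where
  "time_level n = time_mem n + time_comp n + time_rest n + 2 * time_wsum n + time_merge n + 20 * n + 400"

text \<open>The outer \<open>n + 1\<close> counts the sets in the chain of deletions, including the
  empty one. The inner \<open>n + 1\<close> counts up to \<open>n\<close> tests plus one repeated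
  call on the chosen branch, because \<open>find_proc\<close> returns only the vertex and not the
  set found there.\<close>

fun time_solve :: "nat \<Rightarrow> nat \<Rightarrow> nat" where
  "time_solve n 0 = time_level n"
| "time_solve n (Suc k) = (n + 1) * ((n + 1) * (time_level n + time_solve n k) + time_level n)"

locale nat_graph =
  fixes G :: "nat graph" and n :: nat and w :: "nat \<Rightarrow> nat"
  assumes simple: "simple_graph G" and verts: "verts G = {..<n}"
begin

definition M :: "nat \<Rightarrow> nat" where
  "M = input_memory G w"

lemma M_0 [simp]: "M 0 = n"
  by (simp add: M_def input_memory_def verts)

lemma M_weight: "v < n \<Longrightarrow> M (Suc v) = w v"
  by (simp add: M_def input_memory_def verts zero_extend_def nth_append)

lemma M_edge:
  assumes "u < n" "v < n"
  shows "M (Suc (n + (u * n + v))) = of_bool ((u, v) \<in> edges G)"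
proof -
  have "u * n + v < n * n"
  proof -
    have "u * n + v < Suc u * n" using assms by simp
    also have "\<dots> \<le> n * n" using assms by (intro mult_le_mono1) simp
    finally show ?thesis .
  qed
  moreover have "(u * n + v) div n = u" "(u * n + v) mod n = v"
    using assms by simp_all
  ultimately show ?thesis
    by (simp add: M_def input_memory_def verts zero_extend_def nth_append)
qed

lemma edge_less: "(u, v) \<in> edges G \<Longrightarrow> u < n \<and> v < n"
  using simple verts by (auto simp: simple_graph_def)

lemma finite_sub: "A \<subseteq> {..<n} \<Longrightarrow> finite A"
  using finite_subset by blast

lemma mem_M:
  "A \<subseteq> {..<n} \<Longrightarrow> v < n \<Longrightarrow> computes prog mem_proc [set_encode A, v] M (of_bool (v \<in> A)) (time_mem n)"
  unfolding time_mem_def by (rule mem_correct)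

lemma adj_correct:
  assumes "u < n" "v < n"
  shows "computes prog adj_proc [u, v] M (of_bool ((u, v) \<in> edges G)) (20 * n + 50)"
  using mul_correct[of u n M] M_edge[OF assms] assms
  by (intro computesI[OF proc_less(5) prog_nth(6)]) (simp add: adj_body_def computes_def add.assoc)

lemma nbr_correct:
  assumes "C \<subseteq> {..<n}" "u < n" "x < n"
  shows "computes prog nbr_proc [x, set_encode C, u, 0] M (of_bool (x \<in> C \<and> (x, u) \<in> edges G)) (time_nbr n)"
  using mem_M[OF assms(1,3)] adj_correct[OF assms(3,2)]
  by (intro computesI[OF proc_less(6) prog_nth(7)])
    (auto simp add: nbr_body_def computes_def time_nbr_def)

lemma nbrs_correct:
  assumes "C \<subseteq> {..<n}" "u < n"
  shows "computes prog nbrs_proc [n, set_encode C, u, 0] M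
    (set_encode {x. x < n \<and> x \<in> C \<and> (x, u) \<in> edges G}) (time_nbrs n)"
  unfolding time_nbrs_def using nbr_correct[OF assms]
  by (intro collect_correct[OF proc_less(7) prog_nth(8)]) fastforce+

section \<open>Components by breadth-first search\<close>

definition expand :: "nat set \<Rightarrow> nat set \<Rightarrow> nat set" where
  "expand S C = C \<union> {u \<in> S. \<exists>x\<in>C. (x, u) \<in> edges G}"

lemma expand_subset: "C \<subseteq> {..<n} \<Longrightarrow> expand S C \<subseteq> {..<n}"
  using edge_less by (auto simp: expand_def)

lemma grow_correct:
  assumes "C \<subseteq> {..<n}" "S \<subseteq> {..<n}" "u < n"
  shows "\<exists>r. computes prog grow_proc [u, set_encode C, set_encode S, 0] M r (time_grow n)
    \<and> (r \<noteq> 0 \<longleftrightarrow> u \<in> expand S C)"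
proof -
  define X where "X = {x. x < n \<and> x \<in> C \<and> (x, u) \<in> edges G}"
  define r where "r = (if u \<in> C then 1 else if u \<in> S then set_encode X else 0)"
  have "computes prog grow_proc [u, set_encode C, set_encode S, 0] M r (time_grow n)"
    using mem_M[OF assms(1,3)] mem_M[OF assms(2,3)] nbrs_correct[OF assms(1,3), folded X_def]
    by (intro computesI[OF proc_less(8) prog_nth(9)])
      (auto simp: grow_body_def computes_def time_grow_def r_def)
  moreover have "r \<noteq> 0 \<longleftrightarrow> u \<in> expand S C"
    using set_encode_eq_0[of X] edge_less by (auto simp: r_def X_def expand_def)
  ultimately show ?thesis by blast
qed

lemma step_correct:
  assumes "C \<subseteq> {..<n}" "S \<subseteq> {..<n}"
  shows "computes prog step_proc [n, set_encode C, set_encode S, 0] M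
    (set_encode (expand S C)) (time_step n)"
proof -
  have "{u. u < n \<and> u \<in> expand S C} = expand S C"
    using expand_subset[OF assms(1), of S] by auto
  then show ?thesis
    using collect_correct[OF proc_less(9) prog_nth(10) grow_correct[OF assms], of n n]
    by (simp add: time_step_def)
qed

lemma iter_correct:
  assumes "C \<subseteq> {..<n}" "S \<subseteq> {..<n}"
  shows "computes prog iter_proc [j, set_encode C, set_encode S] M
    (set_encode ((expand S ^^ j) C)) (j * (time_step n + 60) + 20)"
  using assms(1)
proof (induction j arbitrary: C)
  case 0
  show ?case
    by (intro computesI[OF proc_less(10) prog_nth(11)]) (simp add: iter_body_def)
next
  case (Suc j)
  show ?case
    using Suc.IH[OF expand_subset[OF Suc.prems, of S]] step_correct[OF Suc.prems assms(2)]
    unfolding funpow_Suc_right o_apply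
    by (intro computesI[OF proc_less(10) prog_nth(11)]) (simp add: iter_body_def computes_def)
qed

lemma expand_power:
  assumes "v \<in> S"
  shows "(expand S ^^ j) {v} = {u. \<exists>i\<le>j. (v, u) \<in> (edges G \<inter> S \<times> S) ^^ i}"
proof (induction j)
  case 0
  show ?case by auto
next
  case (Suc j)
  let ?R = "edges G \<inter> S \<times> S"
  \<comment> \<open>\<open>expand\<close> asks only the new endpoint of an edge to lie in
    \<open>S\<close>; that the old one does too is inherited from \<open>v\<close>.\<close>
  have inS: "u \<in> S" if "(v, u) \<in> ?R ^^ i" for u i
    using that assms by (cases i) auto
  have step: "(expand S ^^ Suc j) {v} = expand S {u. \<exists>i\<le>j. (v, u) \<in> ?R ^^ i}"
    by (simp add: Suc.IH)
  show ?case (is "?A = ?B")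
  proof
    show "?A \<subseteq> ?B"
    proof
      fix u assume "u \<in> ?A"
      then consider i where "i \<le> j" "(v, u) \<in> ?R ^^ i"
        | i x where "i \<le> j" "(v, x) \<in> ?R ^^ i" "(x, u) \<in> edges G" "u \<in> S"
        unfolding step by (auto simp: expand_def)
      then show "u \<in> ?B"
      proof cases
        case (2 i x)
        then have "(v, u) \<in> ?R ^^ Suc i"
          using inS by (intro relpow_Suc_I) auto
        with 2 show ?thesis by blast
      qed (auto intro: le_SucI)
    qed
    show "?B \<subseteq> ?A"
    proof
      fix u assume "u \<in> ?B"
      then obtain i where i: "i \<le> Suc j" "(v, u) \<in> ?R ^^ i" by auto
      show "u \<in> ?A"
      proof (cases "i \<le> j")
        case True
        with i show ?thesis unfolding step by (auto simp: expand_def)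
      next
        case False
        with i have "(v, u) \<in> ?R ^^ Suc j"
          by (simp add: le_Suc_eq)
        then obtain x where "(v, x) \<in> ?R ^^ j" "(x, u) \<in> ?R"
          by (rule relpow_Suc_E)
        then show ?thesis unfolding step by (auto simp: expand_def)
      qed
    qed
  qed
qed

text \<open>The number of rounds comes from bounding path lengths by the number of edges, which is
  at most \<open>n * n\<close>.\<close>

lemma expand_power_component:
  assumes "v \<in> S"
  shows "(expand S ^^ (n * n)) {v} = component G S v"
proof -
  let ?R = "edges G \<inter> S \<times> S"
  have sub: "?R \<subseteq> {..<n} \<times> {..<n}"
    using edge_less by auto
  then have fin: "finite ?R"
    using finite_subset by blast
  have "card ?R \<le> n * n"
    using card_mono[OF _ sub] by simp
  then have "component G S v \<subseteq> (expand S ^^ (n * n)) {v}"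
    unfolding expand_power[OF assms] component_def rtrancl_finite_eq_relpow[OF fin]
    by (auto intro: le_trans)
  moreover have "(expand S ^^ (n * n)) {v} \<subseteq> component G S v"
    unfolding expand_power[OF assms] component_def by (auto intro: relpow_imp_rtrancl)
  ultimately show ?thesis by blast
qed

lemma comp_correct:
  assumes "S \<subseteq> {..<n}" "v \<in> S"
  shows "computes prog comp_proc [set_encode S, v] M (set_encode (component G S v)) (time_comp n)"
proof -
  have "v < n" using assms by auto
  moreover have "computes prog iter_proc [n * n, 2 ^ v, set_encode S] M
      (set_encode (component G S v)) (n * n * (time_step n + 60) + 20)"
    using iter_correct[of "{v}" S "n * n"] assms \<open>v < n\<close> by (simp add: expand_power_component)
  ultimately show ?thesis
    using mul_correct[of n n M] pow_correct[of v M]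
    by (intro computesI[OF proc_less(11) prog_nth(12)])
      (simp add: comp_body_def computes_def time_comp_def)
qed

lemma far_correct:
  assumes "C \<subseteq> {..<n}" "v < n" "u < n"
  shows "\<exists>r. computes prog far_proc [u, set_encode C, v, 0] M r (2 * time_nbr n)
    \<and> (r \<noteq> 0 \<longleftrightarrow> u \<in> C - closed_nbhd G v)"
proof -
  define r :: nat where "r = of_bool (u \<in> C) - of_bool ((v, u) \<in> edges G) - of_bool (u = v)"
  have "computes prog far_proc [u, set_encode C, v, 0] M r (2 * time_nbr n)"
    using mem_M[OF assms(1,3)] adj_correct[OF assms(2,3)]
    by (intro computesI[OF proc_less(12) prog_nth(13)])
      (auto simp: far_body_def computes_def time_nbr_def r_def)
  moreover have "r \<noteq> 0 \<longleftrightarrow> u \<in> C - closed_nbhd G v"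
    by (auto simp: closed_nbhd_def r_def)
  ultimately show ?thesis by blast
qed

lemma rest_correct:
  assumes "C \<subseteq> {..<n}" "v < n"
  shows "computes prog rest_proc [n, set_encode C, v, 0] M
    (set_encode (C - closed_nbhd G v)) (time_rest n)"
proof -
  have "{u. u < n \<and> u \<in> C - closed_nbhd G v} = C - closed_nbhd G v"
    using assms(1) by auto
  then show ?thesis
    using collect_correct[OF proc_less(13) prog_nth(14) far_correct[OF assms], of n n]
    by (simp add: time_rest_def)
qed

lemma wsum_correct:
  assumes "A \<subseteq> {..<n}" "B \<subseteq> {..<n}" "i \<le> n"
  shows "computes prog wsum_proc [i, set_encode A, set_encode B] M
    (sum w {u \<in> A \<inter> B. u < i}) (i * (2 * time_mem n + 80) + 20)"
  using assms(3)
proof (induction i)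
  case 0
  show ?case
    by (intro computesI[OF proc_less(14) prog_nth(15)]) (simp add: wsum_body_def)
next
  case (Suc i)
  have "{u \<in> A \<inter> B. u < Suc i} =
      (if i \<in> A \<inter> B then insert i {u \<in> A \<inter> B. u < i} else {u \<in> A \<inter> B. u < i})"
    by (auto simp: less_Suc_eq)
  then have *: "sum w {u \<in> A \<inter> B. u < Suc i} =
      sum w {u \<in> A \<inter> B. u < i} + (if i \<in> A \<and> i \<in> B then w i else 0)"
    by simp
  show ?case
    unfolding *
    using Suc mem_M[OF assms(1), of i] mem_M[OF assms(2), of i] M_weight[of i]
    by (intro computesI[OF proc_less(14) prog_nth(15)]) (simp add: wsum_body_def computes_def)
qed

lemma wsum_n_correct:
  assumes "A \<subseteq> {..<n}" "B \<subseteq> {..<n}"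
  shows "computes prog wsum_proc [n, set_encode A, set_encode B] M (sum w (A \<inter> B)) (time_wsum n)"
proof -
  have "{u \<in> A \<inter> B. u < n} = A \<inter> B" using assms by auto
  then show ?thesis
    using wsum_correct[OF assms order_refl] by (simp add: time_wsum_def)
qed

lemma pick_correct:
  assumes "C \<subseteq> {..<n}" "I \<subseteq> {..<n}" "J \<subseteq> {..<n}" "u < n"
  shows "computes prog pick_proc [u, set_encode C, set_encode I, set_encode J] M
    (of_bool (u \<in> (I - C) \<union> C \<inter> J)) (2 * time_mem n + 50)"
  using mem_M[OF assms(1,4)] mem_M[OF assms(2,4)] mem_M[OF assms(3,4)]
  by (intro computesI[OF proc_less(15) prog_nth(16)]) (auto simp: pick_body_def computes_def)

lemma merge_correct:
  assumes "C \<subseteq> {..<n}" "I \<subseteq> {..<n}" "J \<subseteq> {..<n}" "J \<subseteq> C"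
  shows "computes prog merge_proc [n, set_encode C, set_encode I, set_encode J] M
    (set_encode ((I - C) \<union> J)) (time_merge n)"
proof -
  have "(I - C) \<union> J = {u. u < n \<and> u \<in> (I - C) \<union> C \<inter> J}"
    using assms by auto
  moreover have "computes prog merge_proc [n, set_encode C, set_encode I, set_encode J] M
    (set_encode {u. u < n \<and> u \<in> (I - C) \<union> C \<inter> J}) (n * (2 * time_mem n + 50 + 20 * n + 60) + 20)"
    using pick_correct[OF assms(1-3)]
    by (intro collect_correct[OF proc_less(16) prog_nth(17)]) fastforce+
  ultimately show ?thesis
    unfolding time_merge_def by (simp add: add.commute add.left_commute)
qed

section \<open>The threshold solver\<close>

definition solves :: "nat set \<Rightarrow> nat \<Rightarrow> nat \<Rightarrow> bool" where
  "solves S k T \<longleftrightarrow> (\<exists>r. computes prog solve_proc [set_encode S, k] M r T \<and>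
     (if nd (induced G S) \<le> k
      then \<exists>I\<subseteq>S. max_weight_independent (induced G S) w I \<and> r = Suc (set_encode I)
      else r = 0))"

definition branch :: "nat set \<Rightarrow> nat \<Rightarrow> nat set" where
  "branch S v = component G S v - closed_nbhd G v"

lemma branch_subset: "v \<in> S \<Longrightarrow> branch S v \<subseteq> S"
  using component_subset' unfolding branch_def by fast

text \<open>Variable 4 holds first the membership bit and then the answer of the solver, so a vertex
  outside \<open>S\<close> and a failed test both lead to the recursive call. The search runs
  downwards and stops at the first success.\<close>

lemma find_correct:
  assumes S: "S \<subseteq> {..<n}" and i: "i \<le> n"
    and sol: "\<And>S'. S' \<subseteq> {..<n} \<Longrightarrow> solves S' k T"
  shows "\<exists>r. computes prog find_proc [i, set_encode S, Suc k] M r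
      (i * (time_mem n + time_comp n + time_rest n + T + 100) + 20) \<and>
    (r = 0 \<and> (\<forall>v\<in>S. v < i \<longrightarrow> \<not> nd (induced G (branch S v)) \<le> k) \<or>
     (\<exists>v\<in>S. r = Suc v \<and> nd (induced G (branch S v)) \<le> k))"
  using i
proof (induction i)
  case 0
  have "computes prog find_proc [0, set_encode S, Suc k] M 0 20"
    by (intro computesI[OF proc_less(18) prog_nth(19)]) (simp add: find_body_def)
  then show ?case by auto
next
  case (Suc i)
  then obtain r0 where r0: "computes prog find_proc [i, set_encode S, Suc k] M r0
      (i * (time_mem n + time_comp n + time_rest n + T + 100) + 20)"
    "r0 = 0 \<and> (\<forall>v\<in>S. v < i \<longrightarrow> \<not> nd (induced G (branch S v)) \<le> k) \<or>
     (\<exists>v\<in>S. r0 = Suc v \<and> nd (induced G (branch S v)) \<le> k)"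
    by auto
  let ?T = "Suc i * (time_mem n + time_comp n + time_rest n + T + 100) + 20"
  note mem = mem_M[OF S, of i]
  show ?case
  proof (cases "i \<in> S")
    case False
    have "computes prog find_proc [Suc i, set_encode S, Suc k] M r0 ?T"
      using mem Suc.prems r0(1) False
      by (intro computesI[OF proc_less(18) prog_nth(19)]) (simp add: find_body_def computes_def)
    with r0(2) False show ?thesis by (metis less_Suc_eq)
  next
    case True
    have C: "component G S i \<subseteq> {..<n}"
      using component_subset'[OF True] S by blast
    have "branch S i \<subseteq> {..<n}"
      using branch_subset[OF True] S by blast
    from sol[OF this] obtain r1 where r1: "computes prog solve_proc [set_encode (branch S i), k] M r1 T"
      "r1 \<noteq> 0 \<longleftrightarrow> nd (induced G (branch S i)) \<le> k"
      unfolding solves_def by (auto split: if_splits)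
    have "computes prog find_proc [Suc i, set_encode S, Suc k] M (if r1 = 0 then r0 else Suc i) ?T"
      using mem Suc.prems r0(1) r1(1) True comp_correct[OF S True]
        rest_correct[OF C, of i, folded branch_def]
      by (intro computesI[OF proc_less(18) prog_nth(19)]) (simp add: find_body_def computes_def)
    moreover have "(if r1 = 0 then r0 else Suc i) = 0 \<and> (\<forall>v\<in>S. v < Suc i \<longrightarrow> \<not> nd (induced G (branch S v)) \<le> k) \<or>
     (\<exists>v\<in>S. (if r1 = 0 then r0 else Suc i) = Suc v \<and> nd (induced G (branch S v)) \<le> k)"
      using r0(2) r1(2) True less_Suc_eq by auto
    ultimately show ?thesis by blast
  qed
qed

lemma nd_le_0_iff: "S \<subseteq> {..<n} \<Longrightarrow> nd (induced G S) = 0 \<longleftrightarrow> S = {}"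
  using nd_eq_0_iff[OF simple_graph_induced[OF simple], of S] verts by auto

lemma solve_empty: "T \<ge> 20 \<Longrightarrow> solves {} k T"
proof -
  assume T: "T \<ge> 20"
  have "computes prog solve_proc [0, k] M 1 T"
    using T by (intro computesI[OF proc_less(17) prog_nth(18)]) (simp add: solve_body_def)
  moreover have "max_weight_independent (induced G {}) w {}"
    by (auto simp: max_weight_independent_def independent_def)
  ultimately show ?thesis
    unfolding solves_def using nd_le_0_iff[of "{}"] by (intro exI[of _ 1]) auto
qed

lemma solve_0:
  assumes "S \<subseteq> {..<n}" and T: "T \<ge> 20"
  shows "solves S 0 T"
proof (cases "S = {}")
  case False
  then have "set_encode S \<noteq> 0"
    using set_encode_eq_0[of S] finite_sub[OF assms(1)] by simp
  then have "computes prog solve_proc [set_encode S, 0] M 0 T"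
    using T by (intro computesI[OF proc_less(17) prog_nth(18)]) (simp add: solve_body_def)
  then show ?thesis
    unfolding solves_def using nd_le_0_iff[OF assms(1)] False by auto
qed (use solve_empty T in simp)

text \<open>Inner induction along the chain of deletions at a fixed threshold; \<open>sol\<close> is
  the hypothesis of the outer induction on the threshold and covers all branches.\<close>

lemma solve_Suc:
  assumes sol: "\<And>S'. S' \<subseteq> {..<n} \<Longrightarrow> solves S' k T"
    and S: "S \<subseteq> {..<n}"
  shows "solves S (Suc k) ((card S + 1) * ((n + 1) * (time_level n + T) + time_level n))"
  using S
proof (induction "card S" arbitrary: S)
  case 0
  then have "S = {}" using finite_sub by auto
  then show ?case by (auto intro!: solve_empty simp: time_level_def)
next
  case (Suc s S)
  let ?X = "(n + 1) * (time_level n + T) + time_level n"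
  have ne: "S \<noteq> {}" "finite S"
    using Suc.hyps(2) finite_sub[OF Suc.prems] by auto
  have S0: "set_encode S > 0"
    using set_encode_eq_0[of S] ne by simp
  obtain f where f: "computes prog find_proc [n, set_encode S, Suc k] M f
      (n * (time_mem n + time_comp n + time_rest n + T + 100) + 20)"
    "f = 0 \<and> (\<forall>v\<in>S. v < n \<longrightarrow> \<not> nd (induced G (branch S v)) \<le> k) \<or>
     (\<exists>v\<in>S. f = Suc v \<and> nd (induced G (branch S v)) \<le> k)"
    using find_correct[OF Suc.prems order_refl sol] by blast
  have level: "time_comp n + time_rest n + 2 * time_wsum n + time_merge n + 20 * n + 400 \<le> time_level n"
    by (simp add: time_level_def)
  have "n * (time_mem n + time_comp n + time_rest n + T + 100) \<le> n * (time_level n + T)"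
    by (intro mult_le_mono2) (simp add: time_level_def)
  then have fT: "computes prog find_proc [n, set_encode S, Suc k] M f (n * (time_level n + T) + 20)"
    by (intro computes_mono[OF f(1)]) simp
  have SV: "S \<subseteq> verts G" using Suc.prems verts by simp
  show ?case
  proof (cases "f = 0")
    case True
    have "computes prog solve_proc [set_encode S, Suc k] M 0 ?X"
      using fT True S0 level
      by (intro computesI[OF proc_less(17) prog_nth(18)])
        (simp add: solve_body_def computes_def)
    then have "computes prog solve_proc [set_encode S, Suc k] M 0 ((card S + 1) * ?X)"
      by (rule computes_mono) simp
    moreover have "\<not> nd (induced G S) \<le> Suc k"
      using nd_induced_leD[OF simple SV ne(1), of "Suc k"] f(2) True Suc.prems
      by (auto simp: branch_def less_Suc_eq_le)
    ultimately show ?thesis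
      unfolding solves_def by auto
  next
    case False
    then obtain v where v: "v \<in> S" "f = Suc v" "nd (induced G (branch S v)) \<le> k"
      using f(2) by auto
    have vn: "v < n" using v Suc.prems by auto
    have "solves (S - {v}) (Suc k) ((card (S - {v}) + 1) * ?X)"
      using Suc v by (intro Suc.hyps(1)) auto
    then have "solves (S - {v}) (Suc k) (card S * ?X)"
      using v ne Suc.hyps(2) by simp
    then obtain r where r: "computes prog solve_proc [set_encode (S - {v}), Suc k] M r (card S * ?X)"
      "if nd (induced G (S - {v})) \<le> Suc k
       then \<exists>I\<subseteq>S - {v}. max_weight_independent (induced G (S - {v})) w I \<and> r = Suc (set_encode I)
       else r = 0"
      unfolding solves_def by blast
    have del: "set_encode S - 2 ^ v = set_encode (S - {v})"
      using set_encode_insert[of "S - {v}" v] ne v by (simp add: insert_absorb)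
    show ?thesis
    proof (cases "nd (induced G (S - {v})) \<le> Suc k")
      case nle: False
      have "computes prog solve_proc [set_encode S, Suc k] M 0 ((card S + 1) * ?X)"
        using fT v(2) S0 level r nle pow_correct[of v M] vn
        by (intro computesI[OF proc_less(17) prog_nth(18)])
          (simp add: solve_body_def computes_def del)
      \<comment> \<open>Monotonicity: failure after deleting this one \<open>v\<close> already
        refutes \<open>S\<close>, so no other vertex has to be tried.\<close>
      moreover have "\<not> nd (induced G S) \<le> Suc k"
        using nd_mono[OF simple, of "S - {v}" S] nle by auto
      ultimately show ?thesis
        unfolding solves_def by auto
    next
      case le: True
      then obtain I where I: "I \<subseteq> S - {v}" "max_weight_independent (induced G (S - {v})) w I"
        "r = Suc (set_encode I)"
        using r(2) by auto
      define C where "C = component G S v"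
      have C: "C \<subseteq> {..<n}" "v \<in> C"
        using component_subset'[OF v(1)] Suc.prems component_self[of v] unfolding C_def by auto
      have br: "branch S v \<subseteq> {..<n}"
        using branch_subset[OF v(1)] Suc.prems by blast
      from sol[OF br] v(3) obtain J where J: "J \<subseteq> branch S v"
        "max_weight_independent (induced G (branch S v)) w J"
        "computes prog solve_proc [set_encode (branch S v), k] M (Suc (set_encode J)) T"
        unfolding solves_def by auto
      have vJ: "v \<notin> J" using J(1) by (auto simp: branch_def closed_nbhd_def)
      have JC: "insert v J \<subseteq> C" using J(1) C(2) by (auto simp: branch_def C_def)
      have Jn: "insert v J \<subseteq> {..<n}" "I \<subseteq> {..<n}" using JC C I Suc.prems by auto
      have enc: "2 ^ v + set_encode J = set_encode (insert v J)"
        using set_encode_insert[of J v] vJ Jn finite_sub by auto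
      define I' where "I' = (if sum w (C \<inter> I) < sum w (insert v J) then (I - C) \<union> insert v J else I)"
      have "computes prog solve_proc [set_encode S, Suc k] M (Suc (set_encode I')) ((card S + 1) * ?X)"
        using fT v(2) S0 level r(1) I(3) J(3) pow_correct[of v M] vn
          comp_correct[OF Suc.prems v(1), folded C_def]
          rest_correct[OF C(1) vn, folded branch_def[of S v, folded C_def]]
          wsum_n_correct[OF C(1) Jn(2)] wsum_n_correct[OF Jn(1) Jn(1)]
          merge_correct[OF C(1) Jn(2,1) JC]
        by (intro computesI[OF proc_less(17) prog_nth(18)])
          (simp add: solve_body_def computes_def del enc I'_def)
      moreover have "max_weight_independent (induced G S) w I'"
        unfolding I'_def
        by (rule max_weight_independent_extend[OF simple SV v(1) C_def I(2)])
          (use J(2) in \<open>simp add: branch_def C_def\<close>)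
      moreover have "I' \<subseteq> S"
        using I(1) JC component_subset'[OF v(1), of G] by (auto simp: I'_def C_def)
      moreover have "nd (induced G S) \<le> Suc k"
        using nd_induced_leI[OF simple SV v(1) _ le] v(3) by (simp add: branch_def less_Suc_eq_le)
      ultimately show ?thesis
        unfolding solves_def by auto
    qed
  qed
qed

lemma solve_correct:
  assumes "S \<subseteq> {..<n}"
  shows "solves S k (time_solve n k)"
  using assms
proof (induction k arbitrary: S)
  case 0
  then show ?case by (auto intro!: solve_0 simp: time_level_def)
next
  case (Suc k)
  have "card S + 1 \<le> n + 1"
    using card_mono[OF _ Suc.prems] by simp
  then show ?case
    using solve_Suc[OF Suc.IH Suc.prems] unfolding solves_def time_solve.simps
    by (meson computes_mono mult_le_mono1)
qed

end

section \<open>The search for the neighbor-depth and the output\<close>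

lemma time_solve_Suc_ge: "time_solve n k \<le> time_solve n (Suc k)"
  by simp

lemma time_solve_mono: "i \<le> j \<Longrightarrow> time_solve n i \<le> time_solve n j"
  by (rule lift_Suc_mono_le[of "time_solve n", OF time_solve_Suc_ge])

context nat_graph
begin

lemma induced_all: "induced G {..<n} = G"
  using induced_superset[OF simple, of "{..<n}"] verts by simp

text \<open>\<open>d\<close>, the distance from the current threshold to the depth, is the
  termination measure; the program itself contains no bound on its search.\<close>

lemma search_correct:
  assumes "j + d = nd G"
  shows "computes prog search_proc [j, set_encode {..<n}] M (nd G) ((d + 1) * (time_solve n (nd G) + 60))"
  using assms
proof (induction d arbitrary: j)
  case 0
  obtain r where "computes prog solve_proc [set_encode {..<n}, j] M r (time_solve n j)" "r \<noteq> 0"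
    using solve_correct[OF order_refl, of j] 0 unfolding solves_def induced_all by auto
  then show ?case
    using 0 by (intro computesI[OF proc_less(19) prog_nth(20)]) (simp add: search_body_def computes_def)
next
  case (Suc d)
  have "computes prog solve_proc [set_encode {..<n}, j] M 0 (time_solve n j)"
    using solve_correct[OF order_refl, of j] Suc.prems unfolding solves_def induced_all by auto
  moreover have "time_solve n j \<le> time_solve n (nd G)"
    using Suc.prems by (intro time_solve_mono) simp
  moreover have "computes prog search_proc [Suc j, set_encode {..<n}] M (nd G)
      ((d + 1) * (time_solve n (nd G) + 60))"
    using Suc by simp
  ultimately show ?case
    by (intro computesI[OF proc_less(19) prog_nth(20)]) (simp add: search_body_def computes_def)
qed

text \<open>The memory changes during the loop, so membership is taken from
  \<open>mem_correct\<close>, which holds for every memory, and not from \<open>mem_M\<close>.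
  Variable 2 carries the depth, which is stored only after the loop.\<close>

lemma write_loop:
  assumes A: "A \<subseteq> {..<n}" and "l 0 \<le> n" "l 3 = set_encode A"
  shows "wp prog (While (Var 0) write_body) l m a (\<lambda>l' m' b. l' 2 = l 2 \<and>
    (\<forall>v. m' (Suc v) = (if v < l 0 then of_bool (v \<in> A) else m (Suc v))) \<and>
    b \<le> a + l 0 * (time_mem n + 40) + 20)"
  using assms(2,3)
proof (induction "l 0" arbitrary: l m a)
  case 0
  then show ?case
    by (subst wp_While) simp
next
  case (Suc i)
  note eq = Suc.hyps(2)
  have mem: "computes prog mem_proc [set_encode A, i] m (of_bool (i \<in> A)) (time_mem n)"
    unfolding time_mem_def using mem_correct[OF A] Suc.prems eq by simp
  let ?t = "time prog mem_proc [set_encode A, i] m"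
  have "l 0 - 1 = i" using eq by simp
  define l2 where "l2 = l(4 := i, 5 := of_bool (i \<in> A), 0 := i)"
  define m2 where "m2 = m(Suc i := of_bool (i \<in> A))"
  have IH: "wp prog (While (Var 0) write_body) l2 m2 b (\<lambda>l' m' b'. l' 2 = l2 2 \<and>
      (\<forall>v. m' (Suc v) = (if v < l2 0 then of_bool (v \<in> A) else m2 (Suc v))) \<and>
      b' \<le> b + l2 0 * (time_mem n + 40) + 20)" for b
    using Suc.prems eq by (intro Suc.hyps(1)) (auto simp: l2_def)
  have body: "wp prog write_body l m b Q \<longleftrightarrow> Q l2 m2 (b + 12 + ?t)" for b Q
    using mem Suc.prems eq[symmetric]
    by (simp add: write_body_def computes_def l2_def m2_def eval_nat_numeral)
  have "l 0 \<noteq> 0" "?t \<le> time_mem n"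
    using eq mem by (simp_all add: computes_def)
  then show ?case
    by (subst wp_While) (simp add: body, rule wp_mono[OF IH], auto simp: l2_def m2_def not_less_less_Suc_eq simp flip: eq)
qed

text \<open>\<open>nd G + 1\<close> solver calls occur in the search, and one more produces the
  set.\<close>

definition time_main :: nat where
  "time_main = (nd G + 2) * (time_solve n (nd G) + 60) + n * (time_mem n + 60) + 200"

lemma main_correct:
  "\<exists>t m. runs prog M t m \<and> t \<le> time_main \<and> output_nd m = nd G \<and>
    max_weight_independent G w (output_set G m)"
proof -
  let ?k = "nd G"
  obtain I where I: "I \<subseteq> {..<n}" "max_weight_independent G w I"
    "computes prog solve_proc [set_encode {..<n}, ?k] M (Suc (set_encode I)) (time_solve n ?k)"
    using solve_correct[OF order_refl, of ?k] unfolding solves_def induced_all by auto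
  have full: "2 ^ n - Suc 0 = set_encode {..<n}"
    unfolding set_encode_def using sum_power2[of n] by (simp add: atLeast0LessThan)
  have search: "computes prog search_proc [0, set_encode {..<n}] M ?k ((?k + 1) * (time_solve n ?k + 60))"
    by (rule search_correct) simp
  have "wp prog main_body (\<lambda>_. 0) M 0 (\<lambda>l' m' t. t \<le> time_main \<and> m' 0 = ?k \<and>
      (\<forall>v<n. m' (Suc v) = of_bool (v \<in> I)))"
    using I(3) search pow_correct[of n M]
    by (simp add: main_body_def computes_def full, intro wp_mono[OF write_loop[OF I(1)]])
      (simp_all add: time_main_def algebra_simps)
  then obtain t l' m' where e: "exec prog main_body (\<lambda>_. 0, M) t (l', m')"
    and t: "t \<le> time_main" "m' 0 = ?k" "\<forall>v<n. m' (Suc v) = of_bool (v \<in> I)"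
    unfolding wp_def by auto
  have "runs prog M t m'"
    unfolding runs_def using e prog_nth(1) by (auto simp: prog_def)
  moreover have "output_set G m' = I"
    using t(3) I(1) by (auto simp: output_set_def verts)
  ultimately show ?thesis
    using t I(2) unfolding output_nd_def by blast
qed

end

section \<open>The polynomial bound\<close>

text \<open>With base \<open>n + 2\<close>, which is at least 2, constants and sums can be absorbed
  into the exponent for every \<open>n\<close>.\<close>

definition poly_bounded :: "(nat \<Rightarrow> nat) \<Rightarrow> bool" where
  "poly_bounded f \<longleftrightarrow> (\<exists>d. \<forall>n. f n \<le> (n + 2) ^ d)"

lemma poly_bounded_const: "poly_bounded (\<lambda>_. c)"
proof -
  have "c \<le> (n + 2) ^ c" for n
    using less_exp[of c] power_mono[of 2 "n + 2" c] by (meson le_add2 le_trans less_imp_le zero_le)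
  then show ?thesis unfolding poly_bounded_def by blast
qed

lemma poly_bounded_id: "poly_bounded (\<lambda>n. n)"
  unfolding poly_bounded_def by (intro exI[of _ 1]) simp

lemma poly_bounded_add:
  assumes "poly_bounded f" "poly_bounded g"
  shows "poly_bounded (\<lambda>n. f n + g n)"
proof -
  obtain a b where ab: "\<And>n. f n \<le> (n + 2) ^ a" "\<And>n. g n \<le> (n + 2) ^ b"
    using assms unfolding poly_bounded_def by auto
  have "f n + g n \<le> (n + 2) ^ (max a b + 1)" for n
  proof -
    have "(n + 2) ^ a \<le> (n + 2) ^ max a b" "(n + 2) ^ b \<le> (n + 2) ^ max a b"
      by (intro power_increasing; simp)+
    then have "f n + g n \<le> 2 * (n + 2) ^ max a b"
      using ab(1)[of n] ab(2)[of n] by linarith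
    also have "\<dots> \<le> (n + 2) * (n + 2) ^ max a b"
      by (intro mult_le_mono1) simp
    finally show ?thesis by simp
  qed
  then show ?thesis unfolding poly_bounded_def by blast
qed

lemma poly_bounded_mult:
  assumes "poly_bounded f" "poly_bounded g"
  shows "poly_bounded (\<lambda>n. f n * g n)"
proof -
  obtain a b where ab: "\<And>n. f n \<le> (n + 2) ^ a" "\<And>n. g n \<le> (n + 2) ^ b"
    using assms unfolding poly_bounded_def by auto
  have "f n * g n \<le> (n + 2) ^ (a + b)" for n
    unfolding power_add by (intro mult_le_mono ab)
  then show ?thesis unfolding poly_bounded_def by blast
qed

lemmas poly_bounded_intros = poly_bounded_const poly_bounded_id poly_bounded_add poly_bounded_mult

lemma poly_bounded_time_mem: "poly_bounded time_mem"
  unfolding time_mem_def[abs_def] by (intro poly_bounded_intros)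

lemma poly_bounded_time_level: "poly_bounded time_level"
  unfolding time_level_def[abs_def] time_comp_def time_rest_def time_wsum_def time_merge_def
    time_step_def time_grow_def time_nbrs_def time_nbr_def time_mem_def
  by (intro poly_bounded_intros)

lemma time_solve_bound: "\<exists>d. \<forall>n k. time_solve n k \<le> (n + 2) ^ (d * (k + 1))"
proof -
  obtain a where a: "\<And>n. time_level n \<le> (n + 2) ^ a"
    using poly_bounded_time_level unfolding poly_bounded_def by auto
  \<comment> \<open>\<open>a\<close> pays for the work of one level. With \<open>?N = n + 2\<close>,
    the recurrence multiplies the bound by at most \<open>2 * ?N * ?N + ?N\<close>, which is at most
    \<open>?N ^ 4\<close>.\<close>
  let ?d = "a + 4"
  have "time_solve n k \<le> (n + 2) ^ (?d * (k + 1))" for n k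
  proof (induction k)
    case 0
    have "(n + 2) ^ a \<le> (n + 2) ^ (?d * (0 + 1))"
      by (intro power_increasing) auto
    with a[of n] show ?case unfolding time_solve.simps by (rule le_trans)
  next
    case (Suc k)
    let ?N = "n + 2"
    define X where "X = ?N ^ (?d * (k + 1))"
    have l: "time_level n \<le> X"
    proof -
      have "?N ^ a \<le> X" unfolding X_def by (intro power_increasing) auto
      then show ?thesis using a[of n] by simp
    qed
    have "time_solve n (Suc k) \<le> ?N * (?N * (X + X) + X)"
      using Suc.IH l unfolding time_solve.simps X_def[symmetric]
      by (intro mult_le_mono add_le_mono) auto
    also have "\<dots> = (2 * ?N * ?N + ?N) * X"
      by (simp add: algebra_simps)
    also have "2 * ?N * ?N + ?N \<le> 2 * 2 * (?N * ?N)"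
      using mult_le_mono2[of 1 ?N ?N] by simp
    then have "(2 * ?N * ?N + ?N) * X \<le> 2 * 2 * (?N * ?N) * X"
      by (rule mult_le_mono1)
    also have "\<dots> \<le> ?N * ?N * (?N * ?N) * X"
      by (intro mult_le_mono1 mult_le_mono) auto
    also have "\<dots> = ?N ^ 4 * X"
      by (simp only: power4_eq_xxxx mult.assoc)
    also have "\<dots> \<le> ?N ^ ?d * X"
      by (intro mult_le_mono1 power_increasing) auto
    also have "\<dots> = ?N ^ (?d * (Suc k + 1))"
      unfolding X_def power_add[symmetric] by (simp add: algebra_simps)
    finally show ?case .
  qed
  then show ?thesis by blast
qed

lemma time_total_bound:
  "\<exists>d. \<forall>n k. (k + 2) * (time_solve n k + 60) + n * (time_mem n + 60) + 200 \<le> (n + 2) ^ (d * (k + 1))"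
proof -
  obtain d where d: "\<And>n k. time_solve n k \<le> (n + 2) ^ (d * (k + 1))"
    using time_solve_bound by auto
  have "poly_bounded (\<lambda>n. n * (time_mem n + 60) + 200)"
    using poly_bounded_time_mem by (intro poly_bounded_intros)
  then obtain b where b: "\<And>n. n * (time_mem n + 60) + 200 \<le> (n + 2) ^ b"
    unfolding poly_bounded_def by auto
  \<comment> \<open>20 = 6 + 14: the 6 gives \<open>60 \<le> Y\<close> through
    \<open>60 \<le> 2 ^ 6\<close>, and the 14 pays for the factor \<open>2 * k + 5\<close>.\<close>
  let ?e = "d + b + 20"
  have "(k + 2) * (time_solve n k + 60) + n * (time_mem n + 60) + 200 \<le> (n + 2) ^ (?e * (k + 1))" for n k
  proof -
    let ?N = "n + 2"
    define Y where "Y = ?N ^ ((d + b + 6) * (k + 1))"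
    have "?N ^ (d * (k + 1)) \<le> Y"
      unfolding Y_def by (intro power_increasing mult_le_mono1) simp_all
    with d[of n k] have "time_solve n k \<le> Y"
      by (rule le_trans)
    moreover have "60 \<le> Y"
    proof -
      have "(60::nat) \<le> 2 ^ 6" by simp
      also have "\<dots> \<le> ?N ^ 6" by (intro power_mono) auto
      also have "\<dots> \<le> Y" unfolding Y_def by (intro power_increasing) auto
      finally show ?thesis .
    qed
    moreover have "n * (time_mem n + 60) + 200 \<le> Y"
    proof -
      have "?N ^ b \<le> Y" unfolding Y_def by (intro power_increasing) auto
      then show ?thesis using b[of n] by simp
    qed
    ultimately have "(k + 2) * (time_solve n k + 60) + (n * (time_mem n + 60) + 200) \<le> (k + 2) * (Y + Y) + Y"
      by (intro add_le_mono mult_le_mono) auto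
    also have "\<dots> = (2 * k + 5) * Y"
      by (simp add: algebra_simps)
    also have "2 * k + 5 \<le> ?N ^ (14 * (k + 1))"
    proof -
      have "2 * k + 5 \<le> 2 ^ (3 * (k + 1) :: nat)"
        by (induction k) (auto simp: power_add)
      also have "\<dots> \<le> ?N ^ (3 * (k + 1))" by (intro power_mono) auto
      also have "\<dots> \<le> ?N ^ (14 * (k + 1))" by (intro power_increasing) auto
      finally show ?thesis .
    qed
    then have "(2 * k + 5) * Y \<le> ?N ^ (14 * (k + 1)) * Y"
      by (rule mult_le_mono1)
    also have "\<dots> = ?N ^ (?e * (k + 1))"
      unfolding Y_def by (simp add: algebra_simps flip: power_add)
    finally show ?thesis by simp
  qed
  then show ?thesis by blast
qed

text \<open>For a single vertex the power of \<open>n\<close> in the final bound is 1, so the depth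
  must be bounded by a constant for \<open>c\<close> alone to suffice.\<close>

lemma nd_singleton_le:
  assumes "simple_graph G" "verts G = {..<Suc 0}"
  shows "nd G \<le> 1"
proof -
  have "connected_graph G"
    using assms(2) by (auto simp: connected_graph_def)
  moreover have "nd (del_verts G X) = 0" if "0 \<in> X" for X
    using nd_eq_0_iff[OF simple_graph_induced[OF assms(1)]] assms that by (auto simp: del_verts_def)
  ultimately show ?thesis
    using nd_connected_le_iff[OF assms(1), of 1] assms(2) by (auto simp: closed_nbhd_def)
qed

theorem theorem3:
  "\<exists>(P :: program) (c :: nat). \<forall>(n :: nat) (k :: nat) (G :: nat graph) (w :: nat \<Rightarrow> nat).
     simple_graph G \<and> verts G = {..<n} \<and> nd G = k \<longrightarrow>
     (\<exists>t m. runs P (input_memory G w) t m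
        \<and> t \<le> c * n ^ (c * k)
        \<and> output_nd m = k
        \<and> max_weight_independent G w (output_set G m))"
proof -
  obtain d where d: "\<And>n k. (k + 2) * (time_solve n k + 60) + n * (time_mem n + 60) + 200 \<le> (n + 2) ^ (d * (k + 1))"
    using time_total_bound by auto
  \<comment> \<open>The first summand handles \<open>n \<le> 1\<close>, where the power of
    \<open>n\<close> gives no growth; the second is the exponent needed for
    \<open>n \<ge> 2\<close>.\<close>
  define c :: nat where "c = 3 ^ (2 * d) + 4 * d"
  have bound: "(n + 2) ^ (d * (nd G + 1)) \<le> c * n ^ (c * nd G)"
    if G: "simple_graph G" "verts G = {..<n}" for n and G :: "nat graph"
  proof -
    consider "n = 0" | "n = 1" | "n \<ge> 2" by linarith
    then show ?thesis
    proof cases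
      case 1
      \<comment> \<open>The right-hand side is then \<open>c\<close>, because
        \<open>0 ^ 0 = 1\<close>.\<close>
      then have "nd G = 0" using nd_eq_0_iff[OF G(1)] G by simp
      moreover have "2 ^ d \<le> (3::nat) ^ (2 * d)"
        unfolding power_mult by (intro power_mono) simp_all
      then have "2 ^ d \<le> c" by (simp add: c_def)
      ultimately show ?thesis using 1 by (simp add: numeral_2_eq_2)
    next
      case 2
      then have "nd G \<le> 1" using nd_singleton_le[OF G(1)] G by simp
      then have "(3::nat) ^ (d * (nd G + 1)) \<le> 3 ^ (2 * d)"
        by (intro power_increasing) auto
      then have "3 ^ (d * (nd G + 1)) \<le> c"
        unfolding c_def by (rule trans_le_add1)
      then show ?thesis using 2 by (simp add: numeral_3_eq_3)
    next
      case 3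
      then have "nd G \<noteq> 0" using nd_eq_0_iff[OF G(1)] G by (auto simp: lessThan_empty_iff)
      have "n + 2 \<le> n ^ 2"
      proof -
        have "n + 2 \<le> 2 * n" using 3 by simp
        also have "\<dots> \<le> n ^ 2" using 3 by (simp add: power2_eq_square)
        finally show ?thesis .
      qed
      then have "(n + 2) ^ (d * (nd G + 1)) \<le> (n ^ 2) ^ (d * (nd G + 1))"
        by (intro power_mono) auto
      also have "\<dots> = n ^ (2 * d * (nd G + 1))"
        by (simp add: algebra_simps flip: power_mult)
      also have "\<dots> \<le> n ^ (c * nd G)"
      proof (intro power_increasing)
        \<comment> \<open>A non-empty graph has depth at least 1, so
          \<open>nd G + 1 \<le> 2 * nd G\<close>; this removes the additive 1 from the
          exponent.\<close>
        have "2 * d * (nd G + 1) \<le> 2 * d * (2 * nd G)"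
          using \<open>nd G \<noteq> 0\<close> by (intro mult_le_mono2) simp
        also have "\<dots> \<le> c * nd G"
          by (simp add: c_def algebra_simps)
        finally show "2 * d * (nd G + 1) \<le> c * nd G" .
      qed (use 3 in simp)
      also have "\<dots> \<le> c * n ^ (c * nd G)"
      proof -
        have "1 \<le> c" unfolding c_def by (intro trans_le_add1) simp
        then show ?thesis by simp
      qed
      finally show ?thesis .
    qed
  qed
  show ?thesis
  proof (rule exI[of _ prog], rule exI[of _ c], intro allI impI)
    fix n k :: nat and G :: "nat graph" and w :: "nat \<Rightarrow> nat"
    assume *: "simple_graph G \<and> verts G = {..<n} \<and> nd G = k"
    then interpret nat_graph G n w by unfold_locales auto
    have "time_main \<le> c * n ^ (c * k)"
      using d[of "nd G" n] bound[of G n] * unfolding time_main_def by simp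
    with main_correct * show "\<exists>t m. runs prog (input_memory G w) t m \<and> t \<le> c * n ^ (c * k) \<and>
        output_nd m = k \<and> max_weight_independent G w (output_set G m)"
      unfolding M_def by (meson le_trans)
  qed
qed

end
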